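(* Let $\alpha>0$ and let $F(t)$ be a convex Lipschitz function on $(\alpha,\infty)$ with Lipschitz constant $L>0$, such that its supporting lines intersect the vertical axis in $[\underline\gamma,\overline\gamma]$ with $0\le\underline\gamma\le\overline\gamma<\infty$. Then there exists a sequence of locally constant potentials $\{\phi_n\}_{n=1}^\infty$ on some shift space of finite type such that $$\lim_{n\to\infty}P(t\phi_n)=F(t)$$ for every $t\in(\alpha,\infty)$.
   Context: Shift spaces here are symbolic spaces over a finite alphabet $\Lambda$ (such as $\Lambda^{\mathbb Z}$) with the shift map $\sigma$; all $\phi_n$ live on the same space. A potential is locally constant if for some $k$ its value at $x$ depends only on the finite block $x_{-k}\cdots x_k$. The pressure of a continuous potential $\phi$ is $P(\phi)=\sup\{h(\mu)+\int\phi\,d\mu:\mu \text{ a } \sigma\text{-invariant probability measure}\}$. A supporting line of $F$ at $t_0$ is a line through $(t_0,F(t_0))$ lying below the graph of $F$ on $(\alpha,\infty)$; the vertical axis is $\{t=0\}$. *)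

theory Defs
  imports "HOL-Probability.Probability"
begin

section \<open>Shifts of finite type\<close>

text \<open>
  Points are bi-infinite sequences over a finite alphabet contained in \<^typ>\<open>nat\<close>. Up to renaming
  symbols, every finite alphabet is of this form. The type \<^typ>\<open>int \<Rightarrow> nat\<close> carries the product of
  discrete topologies, and \<^const>\<open>borel\<close> on it is the corresponding Borel sigma-algebra.
\<close>

definition shift_map :: "(int \<Rightarrow> nat) \<Rightarrow> int \<Rightarrow> nat" where
  "shift_map x = (\<lambda>i. x (i + 1))"

definition occurs_at :: "nat list \<Rightarrow> (int \<Rightarrow> nat) \<Rightarrow> int \<Rightarrow> bool" where
  "occurs_at w x i \<longleftrightarrow> (\<forall>j<length w. x (i + int j) = w ! j)"

definition shift_of_finite_type :: "(int \<Rightarrow> nat) set \<Rightarrow> bool" where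
  "shift_of_finite_type X \<longleftrightarrow> X \<noteq> {} \<and>
     (\<exists>\<Lambda> W. finite \<Lambda> \<and> finite W \<and>
        X = {x. range x \<subseteq> \<Lambda> \<and> (\<forall>w\<in>W. \<forall>i. \<not> occurs_at w x i)})"

text \<open>Potentials are total functions, but only their values on \<open>X\<close> matter.\<close>

definition locally_constant_on :: "(int \<Rightarrow> nat) set \<Rightarrow> ((int \<Rightarrow> nat) \<Rightarrow> real) \<Rightarrow> bool" where
  "locally_constant_on X \<phi> \<longleftrightarrow>
     (\<exists>k::nat. \<forall>x\<in>X. \<forall>y\<in>X. (\<forall>i\<in>{- int k..int k}. x i = y i) \<longrightarrow> \<phi> x = \<phi> y)"

section \<open>Measure-theoretic entropy\<close>

text \<open>
  Natural logarithms are used throughout. Since \<open>0 * ln 0 = 0\<close> in HOL, null sets contribute nothing.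
\<close>

definition partition_entropy :: "'a measure \<Rightarrow> 'a set set \<Rightarrow> real" where
  "partition_entropy M P = - (\<Sum>A\<in>P. measure M A * ln (measure M A))"

text \<open>
  The join of \<open>T\<^sup>-\<^sup>i P\<close> over \<open>i < n\<close>. The empty set may be among its members; this does not
  affect the entropy.
\<close>

definition iterated_join :: "'a measure \<Rightarrow> ('a \<Rightarrow> 'a) \<Rightarrow> 'a set set \<Rightarrow> nat \<Rightarrow> 'a set set" where
  "iterated_join M T P n =
     {{x \<in> space M. \<forall>i<n. (T ^^ i) x \<in> f i} | f. \<forall>i<n. f i \<in> P}"

text \<open>If \<open>T\<close> preserves the probability measure \<open>M\<close>, the limit exists by subadditivity.\<close>

definition entropy_rate :: "'a measure \<Rightarrow> ('a \<Rightarrow> 'a) \<Rightarrow> 'a set set \<Rightarrow> real" where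
  "entropy_rate M T P = lim (\<lambda>n. partition_entropy M (iterated_join M T P n) / real n)"

definition KS_entropy :: "'a measure \<Rightarrow> ('a \<Rightarrow> 'a) \<Rightarrow> ereal" where
  "KS_entropy M T =
     (SUP P\<in>{P. finite P \<and> P \<subseteq> sets M \<and> partition_on (space M) P}. ereal (entropy_rate M T P))"

section \<open>Pressure\<close>

definition invariant_measures :: "(int \<Rightarrow> nat) set \<Rightarrow> (int \<Rightarrow> nat) measure set" where
  "invariant_measures X =
     {\<mu>. prob_space \<mu> \<and> sets \<mu> = sets (restrict_space borel X) \<and>
         shift_map \<in> measurable \<mu> \<mu> \<and> distr \<mu> \<mu> shift_map = \<mu>}"

definition pressure :: "(int \<Rightarrow> nat) set \<Rightarrow> ((int \<Rightarrow> nat) \<Rightarrow> real) \<Rightarrow> ereal" where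
  "pressure X \<phi> =
     (SUP \<mu>\<in>invariant_measures X. KS_entropy \<mu> shift_map + ereal (integral\<^sup>L \<mu> \<phi>))"

section \<open>Supporting lines\<close>

text \<open>
  The line \<open>s = m * t + c\<close>, which meets the vertical axis at height \<open>c\<close>, supports \<open>F\<close> at \<open>t\<^sub>0\<close>.
\<close>

definition supporting_line_at :: "real set \<Rightarrow> (real \<Rightarrow> real) \<Rightarrow> real \<Rightarrow> real \<Rightarrow> real \<Rightarrow> bool" where
  "supporting_line_at I F t\<^sub>0 m c \<longleftrightarrow> m * t\<^sub>0 + c = F t\<^sub>0 \<and> (\<forall>t\<in>I. m * t + c \<le> F t)"

end

theory Submission
  imports Defs "HOL-Real_Asymp.Real_Asymp"
begin

text \<open>
  A convex function is the supremum of its supporting lines. By the Lipschitz bound, countably many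
  lines \<open>t \<mapsto> t * m\<^sub>j + c\<^sub>j\<close> suffice, namely those touching the graph over a dense set of points; so
  \<open>F\<close> is the pointwise limit of the finite maxima \<open>max\<^sub>j\<^sub>\<le>\<^sub>n (t * m\<^sub>j + c\<^sub>j)\<close>. It remains to realise such a
  maximum, up to a small error, as \<open>t \<mapsto> P(t\<phi>)\<close> on a full shift that does not depend on \<open>n\<close>.

  The intercept \<open>c\<^sub>j \<ge> 0\<close> is realised as an entropy and the slope \<open>m\<^sub>j\<close> as a mean value of the potential.
  Reserve the letter 0 as a marker, fix a large length \<open>N\<close>, and choose disjoint sets \<open>W\<^sub>j\<close> of about
  \<open>exp (N * c\<^sub>j)\<close> words of length \<open>N\<close> whose only marker is their first letter; since all \<open>c\<^sub>j\<close> are bounded,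
  one alphabet has enough words for every \<open>n\<close>. The potential is \<open>-K\<close>, except that at a marker where a word
  of \<open>W\<^sub>j\<close> starts it has the value \<open>N * m\<^sub>j + (N - 1) * K\<close>. Reading a word of \<open>W\<^sub>j\<close> then collects exactly
  \<open>N * m\<^sub>j\<close>, and every letter outside such words costs \<open>K\<close>. Words with different \<open>j\<close> may be concatenated
  freely, which changes nothing in the limit: heuristically the pressure \<open>p\<close> solves
  \<open>(\<Sum>j\<le>n. exp (N * (t * m\<^sub>j + c\<^sub>j - p))) = 1\<close>, so that it exceeds the maximum by at most \<open>ln (n + 1) / N\<close>.

  The lower bound (\<open>pressure_word_potential_ge\<close>) evaluates entropy and integral for one measure: the
  stationary concatenation of independent, uniformly chosen words of \<open>W\<^sub>j\<close>.

  The upper bound must hold for every invariant measure. Marked words cannot overlap, so deleting the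
  first letter or the first marked word of a block gives a recursion for the partition functions
  (\<open>pressure_word_potential_le\<close>). That exponential growth of partition functions bounds the pressure
  (\<open>pressure_full_shift_le\<close>) rests on Gibbs' inequality alone: an arbitrary finite partition is
  predicted, up to an event of small probability, from the letters in a finite window, and encoding a block
  by its Gibbs weight together with the prediction errors costs at most the logarithm of the
  partition function, less the mean energy, plus an arbitrarily small correction per letter. This contains the part of the Kolmogorov-Sinai generator theorem that
  is needed here.
\<close>

section \<open>Entropy of finite-valued random variables\<close>

text \<open>
  The entropy as the mean of the information function. In this form refining a random variable, shifting
  it, or comparing it with another distribution are pointwise estimates under the integral.
\<close>

definition ent :: "'a measure \<Rightarrow> ('a \<Rightarrow> 'b) \<Rightarrow> real" where
  "ent M V = (\<integral>x. - ln (\<P>(y in M. V y = V x)) \<partial>M)"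

context prob_space
begin

lemma simple_function_event:
  assumes "simple_function M V"
  shows "{x \<in> space M. V x = v} \<in> events"
proof -
  have "V -` {v} \<inter> space M \<in> events"
    using simple_functionD(2)[OF assms] .
  also have "V -` {v} \<inter> space M = {x \<in> space M. V x = v}" by auto
  finally show ?thesis .
qed

lemma integrable_simple_function:
  fixes f :: "'a \<Rightarrow> real"
  assumes "simple_function M f"
  shows "integrable M f"
  by (rule Set_Integral.integrable_simple_function) (use assms in auto)

lemma integrable_comp_simple_function:
  fixes f :: "'b \<Rightarrow> real"
  assumes "simple_function M V"
  shows "integrable M (\<lambda>x. f (V x))"
  using integrable_simple_function[OF simple_function_compose1[OF assms]] .

lemma expectation_simple_function:
  fixes f :: "'b \<Rightarrow> real"
  assumes V: "simple_function M V"
  shows "(\<integral>x. f (V x) \<partial>M) = (\<Sum>v\<in>V ` space M. prob {x \<in> space M. V x = v} * f v)"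
proof -
  have fin: "finite (V ` space M)" using simple_functionD(1)[OF V] .
  have "(\<integral>x. f (V x) \<partial>M) = (\<integral>x. (\<Sum>v\<in>V ` space M. f v * indicator {x \<in> space M. V x = v} x) \<partial>M)"
  proof (rule Bochner_Integration.integral_cong)
    fix x assume "x \<in> space M"
    then show "f (V x) = (\<Sum>v\<in>V ` space M. f v * indicator {x \<in> space M. V x = v} x)"
      using fin by (subst sum.remove[of _ "V x"]) (auto intro!: sum.neutral simp: indicator_def)
  qed simp
  also have "\<dots> = (\<Sum>v\<in>V ` space M. f v * prob {x \<in> space M. V x = v})"
  proof (subst Bochner_Integration.integral_sum)
    fix v
    show "integrable M (\<lambda>x. f v * indicator {x \<in> space M. V x = v} x)"
      using simple_function_event[OF V] by (intro integrable_mult_right) (auto simp: emeasure_eq_measure)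
  next
    show "(\<Sum>v\<in>V ` space M. \<integral>x. f v * indicator {x \<in> space M. V x = v} x \<partial>M) =
        (\<Sum>v\<in>V ` space M. f v * prob {x \<in> space M. V x = v})"
      using simple_function_event[OF V] by (intro sum.cong) auto
  qed
  finally show ?thesis by (simp add: mult.commute)
qed

lemma sum_prob_simple_function:
  assumes "simple_function M V"
  shows "(\<Sum>v\<in>V ` space M. prob {x \<in> space M. V x = v}) = 1"
  using expectation_simple_function[OF assms, of "\<lambda>_. 1"] by (simp add: prob_space)

lemma AE_prob_value_pos:
  assumes V: "simple_function M V"
  shows "AE x in M. 0 < \<P>(y in M. V y = V x)"
proof -
  have "AE x in M. \<forall>v\<in>V ` space M. V x = v \<longrightarrow> 0 < \<P>(y in M. V y = v)"
  proof (rule AE_finite_allI)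
    fix v assume "v \<in> V ` space M"
    show "AE x in M. V x = v \<longrightarrow> 0 < \<P>(y in M. V y = v)"
    proof (cases "\<P>(y in M. V y = v) = 0")
      case True
      then have "AE x in M. x \<notin> {x \<in> space M. V x = v}"
        using simple_function_event[OF V] prob_eq_0 by blast
      then show ?thesis by (rule AE_mp) auto
    next
      case False
      then show ?thesis by (simp add: zero_less_measure_iff)
    qed
  qed (use simple_functionD(1)[OF V] in auto)
  then show ?thesis by (rule AE_mp) (auto intro!: AE_I2)
qed

text \<open>
  Gibbs' inequality, from \<open>ln x \<le> x - 1\<close>. It takes the place of all conditional entropies: an upper
  bound for an entropy is obtained by exhibiting a sub-probability \<open>q\<close>, that is, a code.
\<close>

lemma ent_le_cross_entropy:
  assumes V: "simple_function M V"
    and S: "finite S" "V ` space M \<subseteq> S"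
    and q: "\<And>v. v \<in> S \<Longrightarrow> 0 \<le> q v" "(\<Sum>v\<in>S. q v) \<le> 1"
    and pos: "AE x in M. 0 < q (V x)"
  shows "ent M V \<le> (\<integral>x. - ln (q (V x)) \<partial>M)"
proof -
  let ?p = "\<lambda>v. \<P>(y in M. V y = v)"
  have "(\<integral>x. - ln (?p (V x)) \<partial>M) - (\<integral>x. - ln (q (V x)) \<partial>M)
      = (\<integral>x. - ln (?p (V x)) - - ln (q (V x)) \<partial>M)"
    by (rule Bochner_Integration.integral_diff[symmetric])
      (rule integrable_comp_simple_function[OF V])+
  also have "\<dots> \<le> (\<integral>x. q (V x) / ?p (V x) - 1 \<partial>M)"
  proof (rule integral_mono_AE)
    show "AE x in M. - ln (?p (V x)) - - ln (q (V x)) \<le> q (V x) / ?p (V x) - 1"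
      using pos AE_prob_value_pos[OF V]
    proof eventually_elim
      case (elim x)
      then have "ln (q (V x) / ?p (V x)) \<le> q (V x) / ?p (V x) - 1"
        by (intro ln_le_minus_one divide_pos_pos)
      with elim show ?case by (simp add: ln_div)
    qed
  qed (rule integrable_comp_simple_function[OF V])+
  also have "\<dots> = (\<Sum>v\<in>V ` space M. ?p v * (q v / ?p v - 1))"
    by (rule expectation_simple_function[OF V])
  also have "\<dots> \<le> (\<Sum>v\<in>V ` space M. q v - ?p v)"
    using q(1) S(2) by (intro sum_mono) (auto simp: field_simps)
  also have "\<dots> \<le> 0"
    using sum_mono2[OF S, of q] q by (force simp: sum_subtractf sum_prob_simple_function[OF V])
  finally show ?thesis unfolding ent_def by simp
qed

lemma ent_mono:
  assumes V: "simple_function M V"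
  shows "ent M (\<lambda>x. h (V x)) \<le> ent M V"
  unfolding ent_def
proof (rule integral_mono_AE)
  show "AE x in M. - ln \<P>(y in M. h (V y) = h (V x)) \<le> - ln \<P>(y in M. V y = V x)"
    using AE_prob_value_pos[OF V]
  proof eventually_elim
    case (elim x)
    have "\<P>(y in M. V y = V x) \<le> \<P>(y in M. h (V y) = h (V x))"
      using simple_function_event[OF simple_function_compose1[OF V], of h]
      by (intro finite_measure_mono) auto
    with elim show ?case by simp
  qed
  show "integrable M (\<lambda>x. - ln \<P>(y in M. h (V y) = h (V x)))"
    by (rule integrable_comp_simple_function[OF V, of "\<lambda>v. - ln \<P>(y in M. h (V y) = h v)"])
  show "integrable M (\<lambda>x. - ln \<P>(y in M. V y = V x))"
    by (rule integrable_comp_simple_function[OF V, of "\<lambda>v. - ln \<P>(y in M. V y = v)"])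
qed

lemma ent_nonneg:
  shows "0 \<le> ent M V"
  unfolding ent_def
proof (rule Bochner_Integration.integral_nonneg)
  fix x
  have "\<P>(y in M. V y = V x) \<le> 1" by (rule prob_le_1)
  moreover have "0 \<le> \<P>(y in M. V y = V x)" by simp
  ultimately show "0 \<le> - ln (\<P>(y in M. V y = V x))"
    by (cases "\<P>(y in M. V y = V x) = 0") (auto simp: less_le)
qed

lemma ent_ge:
  assumes V: "simple_function M V" and c: "\<And>x. x \<in> space M \<Longrightarrow> \<P>(y in M. V y = V x) \<le> c"
  shows "- ln c \<le> ent M V"
proof -
  have "- ln c = (\<integral>x. - ln c \<partial>M)" by (simp add: prob_space)
  also have "\<dots> \<le> ent M V"
    unfolding ent_def
  proof (rule integral_mono_AE)
    show "AE x in M. - ln c \<le> - ln \<P>(y in M. V y = V x)"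
      using AE_prob_value_pos[OF V] AE_space
    proof eventually_elim
      case (elim x)
      with c[of x] show ?case by simp
    qed
    show "integrable M (\<lambda>x. - ln \<P>(y in M. V y = V x))"
      by (rule integrable_comp_simple_function[OF V, of "\<lambda>v. - ln \<P>(y in M. V y = v)"])
  qed simp
  finally show ?thesis .
qed

text \<open>
  Gibbs' inequality with the product of the two distributions.
\<close>

lemma ent_Pair_le:
  assumes U: "simple_function M U" and V: "simple_function M V"
  shows "ent M (\<lambda>x. (U x, V x)) \<le> ent M U + ent M V"
proof -
  let ?u = "\<lambda>v. \<P>(y in M. U y = v)" and ?v = "\<lambda>v. \<P>(y in M. V y = v)"
  have "ent M (\<lambda>x. (U x, V x)) \<le> (\<integral>x. - ln (case (U x, V x) of (a, b) \<Rightarrow> ?u a * ?v b) \<partial>M)"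
  proof (rule ent_le_cross_entropy)
    show "finite (U ` space M \<times> V ` space M)"
      using U V by (auto dest: simple_functionD)
    show "(\<Sum>v\<in>U ` space M \<times> V ` space M. case v of (a, b) \<Rightarrow> ?u a * ?v b) \<le> 1"
      unfolding sum.cartesian_product[symmetric] sum_product[symmetric]
      by (simp add: sum_prob_simple_function U V)
    show "AE x in M. 0 < (case (U x, V x) of (a, b) \<Rightarrow> ?u a * ?v b)"
      using AE_prob_value_pos[OF U] AE_prob_value_pos[OF V] by eventually_elim simp
  qed (use U V in auto)
  also have "\<dots> = (\<integral>x. - ln (?u (U x)) + - ln (?v (V x)) \<partial>M)"
  proof (rule integral_cong_AE)
    show "AE x in M. - ln (case (U x, V x) of (a, b) \<Rightarrow> ?u a * ?v b) = - ln (?u (U x)) + - ln (?v (V x))"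
      using AE_prob_value_pos[OF U] AE_prob_value_pos[OF V]
      by eventually_elim (simp add: ln_mult)
    show "(\<lambda>x. - ln (case (U x, V x) of (a, b) \<Rightarrow> ?u a * ?v b)) \<in> borel_measurable M"
      by (rule borel_measurable_integrable, rule integrable_comp_simple_function[OF simple_function_Pair[OF U V],
        of "\<lambda>v. - ln (case v of (a, b) \<Rightarrow> ?u a * ?v b)"])
    show "(\<lambda>x. - ln (?u (U x)) + - ln (?v (V x))) \<in> borel_measurable M"
      by (rule borel_measurable_integrable, rule Bochner_Integration.integrable_add)
        (rule integrable_comp_simple_function[OF U] integrable_comp_simple_function[OF V])+
  qed
  also have "\<dots> = ent M U + ent M V"
    unfolding ent_def
    by (rule Bochner_Integration.integral_add)
        (rule integrable_comp_simple_function[OF U] integrable_comp_simple_function[OF V])+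
  finally show ?thesis .
qed

lemma ent_comp_measure_preserving:
  assumes V: "simple_function M V" and T: "T \<in> measurable M M" "distr M M T = M"
  shows "ent M (\<lambda>x. V (T x)) = ent M V"
proof -
  have "\<P>(y in M. V (T y) = v) = \<P>(y in M. V y = v)" for v
  proof -
    have "\<P>(y in M. V y = v) = measure (distr M M T) {y \<in> space M. V y = v}" by (simp add: T)
    also have "\<dots> = prob (T -` {y \<in> space M. V y = v} \<inter> space M)"
      by (rule measure_distr[OF T(1) simple_function_event[OF V]])
    also have "T -` {y \<in> space M. V y = v} \<inter> space M = {y \<in> space M. V (T y) = v}"
      using measurable_space[OF T(1)] by auto
    finally show ?thesis ..
  qed
  then have "ent M (\<lambda>x. V (T x)) = (\<integral>x. - ln \<P>(y in M. V y = V (T x)) \<partial>M)"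
    unfolding ent_def by simp
  also have "\<dots> = (\<integral>x. - ln \<P>(y in M. V y = V x) \<partial>distr M M T)"
    by (rule integral_distr[symmetric, OF T(1)], rule borel_measurable_integrable,
        rule integrable_comp_simple_function[OF V])
  also have "\<dots> = ent M V" by (simp add: T ent_def)
  finally show ?thesis .
qed

end

section \<open>Itineraries and the entropy rate of a partition\<close>

text \<open>
  Fekete's lemma for nonnegative sequences. Dividing \<open>n\<close> by a fixed \<open>k\<close> with remainder bounds \<open>a n / n\<close>
  by \<open>a k / k\<close> up to an error of order \<open>1 / n\<close>.
\<close>

lemma subadditive_tendsto:
  fixes a :: "nat \<Rightarrow> real"
  assumes nn: "\<And>n. 0 \<le> a n" and sub: "\<And>m n. a (m + n) \<le> a m + a n"
  shows "\<exists>l. (\<lambda>n. a n / real n) \<longlonglongrightarrow> l"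
proof -
  define l where "l = (INF n\<in>{0<..}. a n / real n)"
  have bdd: "bdd_below ((\<lambda>n. a n / real n) ` {0<..})"
    by (rule bdd_belowI[of _ 0]) (auto simp: nn)
  have mult: "a (q * k) \<le> real q * a k + a 0" for q k
  proof (induction q)
    case (Suc q)
    have "a (Suc q * k) \<le> a k + a (q * k)" using sub[of k "q * k"] by simp
    with Suc show ?case by (simp add: algebra_simps)
  qed simp
  have "(\<lambda>n. a n / real n) \<longlonglongrightarrow> l"
  proof (rule LIMSEQ_I)
    fix e :: real assume "0 < e"
    have "\<exists>k\<in>{0<..}. a k / real k < l + e / 2"
      using cINF_less_iff[of "{0<..}", OF _ bdd, of "l + e / 2"] \<open>0 < e\<close> unfolding l_def by auto
    then obtain k where k: "0 < k" "a k / real k < l + e / 2" by auto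
    define b where "b = a 0 + (\<Sum>r<k. a r)"
    have ub: "a n / real n \<le> a k / real k + b / real n" if "0 < n" for n
    proof -
      have "a n \<le> a (n div k * k) + a (n mod k)"
        using sub[of "n div k * k" "n mod k"] by simp
      also have "\<dots> \<le> real (n div k) * a k + a 0 + (\<Sum>r<k. a r)"
        using mult[of "n div k" k] k(1) by (intro add_mono member_le_sum) (auto simp: nn)
      also have "\<dots> \<le> real n / real k * a k + b"
        unfolding b_def using mult_right_mono[OF of_nat_div_le_of_nat[of n k, where 'a=real] nn[of k]] by simp
      finally show ?thesis using that by (simp add: field_simps)
    qed
    have "(\<lambda>n. b / real n) \<longlonglongrightarrow> 0" by (rule lim_const_over_n)
    then have "eventually (\<lambda>n. b / real n < e / 2) sequentially"
      using \<open>0 < e\<close> by (intro order_tendstoD(2)) auto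
    then obtain n0 where n0: "\<And>n. n0 \<le> n \<Longrightarrow> b / real n < e / 2"
      unfolding eventually_sequentially by blast
    have "norm (a n / real n - l) < e" if "n \<ge> max 1 n0" for n
    proof -
      have "l \<le> a n / real n"
        unfolding l_def using that by (intro cINF_lower bdd) auto
      moreover have "a n / real n < l + e"
        using ub[of n] n0[of n] k(2) that by linarith
      ultimately show ?thesis by simp
    qed
    then show "\<exists>no. \<forall>n\<ge>no. norm (a n / real n - l) < e" by blast
  qed
  then show ?thesis ..
qed

definition cell :: "'a set set \<Rightarrow> 'a \<Rightarrow> 'a set" where
  "cell P x = (THE A. A \<in> P \<and> x \<in> A)"

definition itinerary :: "('a \<Rightarrow> 'a) \<Rightarrow> 'a set set \<Rightarrow> nat \<Rightarrow> 'a \<Rightarrow> 'a set list" where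
  "itinerary T P n x = map (\<lambda>i. cell P ((T ^^ i) x)) [0..<n]"

lemma cell_eqI:
  assumes "partition_on S P" "A \<in> P" "x \<in> A"
  shows "cell P x = A"
  unfolding cell_def
  using assms partition_onD2[OF assms(1)] by (intro the_equality) (auto simp: disjoint_def)

lemma cell_mem:
  assumes "partition_on S P" "x \<in> S"
  shows "cell P x \<in> P" "x \<in> cell P x"
proof -
  obtain A where A: "A \<in> P" "x \<in> A"
    using partition_onD1[OF assms(1)] assms(2) by auto
  then show "cell P x \<in> P" "x \<in> cell P x" using cell_eqI[OF assms(1) A] by simp_all
qed

lemma cell_eq_iff:
  assumes "partition_on S P" "A \<in> P" "x \<in> S"
  shows "cell P x = A \<longleftrightarrow> x \<in> A"
  using cell_eqI[OF assms(1,2)] cell_mem[OF assms(1,3)] by auto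

lemma simple_function_map_upt:
  assumes "\<And>i. simple_function M (f i)"
  shows "simple_function M (\<lambda>x. map (\<lambda>i. f i x) [m..<n])"
proof (induction n)
  case (Suc n)
  show ?case
  proof (cases "m \<le> n")
    case True
    have "simple_function M (\<lambda>x. map (\<lambda>i. f i x) [m..<n] @ [f n x])"
      by (rule simple_function_compose2[OF Suc assms])
    then show ?thesis using True by simp
  qed simp
qed simp

locale measure_preserving = prob_space M for M :: "'a measure" and T :: "'a \<Rightarrow> 'a" +
  assumes T_measurable: "T \<in> measurable M M" and distr_T: "distr M M T = M"
begin

lemma T_funpow_measurable: "(T ^^ n) \<in> measurable M M"
  by (rule measurable_compose_n[OF T_measurable])

lemma distr_T_funpow: "distr M M (T ^^ n) = M"
proof (induction n)
  case 0
  then show ?case by (simp add: id_def)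
next
  case (Suc n)
  have "distr M M (T ^^ Suc n) = distr (distr M M (T ^^ n)) M T"
    by (subst distr_distr[OF T_measurable T_funpow_measurable]) simp
  with Suc distr_T show ?case by (simp only:)
qed

lemma T_funpow_space: "x \<in> space M \<Longrightarrow> (T ^^ n) x \<in> space M"
  using measurable_space[OF T_funpow_measurable] .

context
  fixes P :: "'a set set"
  assumes fin: "finite P" and P_sets: "P \<subseteq> sets M" and part: "partition_on (space M) P"
begin

lemma simple_function_cell: "simple_function M (cell P)"
  unfolding simple_function_def
proof
  have im: "cell P ` space M \<subseteq> P" using cell_mem(1)[OF part] by auto
  then show "finite (cell P ` space M)" using fin finite_subset by blast
  show "\<forall>A\<in>cell P ` space M. cell P -` {A} \<inter> space M \<in> sets M"
  proof
    fix A assume "A \<in> cell P ` space M"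
    then have A: "A \<in> P" using im by auto
    then have "cell P -` {A} \<inter> space M = A"
      using cell_eq_iff[OF part A] partition_onD1[OF part] by auto
    then show "cell P -` {A} \<inter> space M \<in> sets M" using A P_sets by auto
  qed
qed

lemma simple_function_cell_funpow: "simple_function M (\<lambda>x. cell P ((T ^^ i) x))"
  by (rule simple_function_comp[OF T_funpow_measurable simple_function_cell])

lemma simple_function_itinerary: "simple_function M (itinerary T P n)"
  unfolding itinerary_def by (rule simple_function_map_upt[OF simple_function_cell_funpow])

lemma itinerary_add: "itinerary T P (m + n) x = itinerary T P m x @ itinerary T P n ((T ^^ m) x)"
proof -
  have shift: "(T ^^ i) ((T ^^ m) x) = (T ^^ (m + i)) x" for i
    by (simp add: add.commute[of m] funpow_add)
  have "map (\<lambda>i. cell P ((T ^^ i) x)) [m..<m+n] = map (\<lambda>i. cell P ((T ^^ i) ((T ^^ m) x))) [0..<n]"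
    unfolding shift by (rule nth_equalityI) auto
  then show ?thesis
    unfolding itinerary_def by (subst upt_add_eq_append) simp_all
qed

text \<open>
  The members of the join are the level sets of the itinerary. The two sums differ only in empty sets,
  which several choices of cells may share and which contribute nothing.
\<close>

lemma partition_entropy_eq_ent: "partition_entropy M (iterated_join M T P n) = ent M (itinerary T P n)"
proof -
  let ?C = "\<lambda>a. {x \<in> space M. itinerary T P n x = a}"
  let ?S = "{a. set a \<subseteq> P \<and> length a = n}"
  have finS: "finite ?S" using fin by (rule finite_lists_length_eq)
  have im: "itinerary T P n ` space M \<subseteq> ?S"
    unfolding itinerary_def using cell_mem(1)[OF part T_funpow_space] by auto
  have C_eq: "{x \<in> space M. \<forall>i<n. (T ^^ i) x \<in> f i} = ?C (map f [0..<n])" if "\<forall>i<n. f i \<in> P" for f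
  proof -
    have "(\<forall>i<n. (T ^^ i) x \<in> f i) \<longleftrightarrow> itinerary T P n x = map f [0..<n]" if "x \<in> space M" for x
      using \<open>\<forall>i<n. f i \<in> P\<close> cell_eq_iff[OF part _ T_funpow_space[OF that]]
      by (simp add: itinerary_def list_eq_iff_nth_eq)
    then show ?thesis by blast
  qed
  have "iterated_join M T P n = ?C ` ?S"
  proof
    show "iterated_join M T P n \<subseteq> ?C ` ?S"
    proof
      fix A assume "A \<in> iterated_join M T P n"
      then obtain f where f: "A = {x \<in> space M. \<forall>i<n. (T ^^ i) x \<in> f i}" "\<forall>i<n. f i \<in> P"
        unfolding iterated_join_def by blast
      then have "A = ?C (map f [0..<n])" "map f [0..<n] \<in> ?S" using C_eq[OF f(2)] by auto
      then show "A \<in> ?C ` ?S" by blast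
    qed
    show "?C ` ?S \<subseteq> iterated_join M T P n"
    proof
      fix A assume "A \<in> ?C ` ?S"
      then obtain a where a: "A = ?C a" "set a \<subseteq> P" "length a = n" by auto
      then have nth: "\<forall>i<n. a ! i \<in> P" by auto
      have "map ((!) a) [0..<n] = a" using a(3) map_nth by blast
      then have "A = {x \<in> space M. \<forall>i<n. (T ^^ i) x \<in> a ! i}"
        using C_eq[OF nth] a(1) by simp
      with nth show "A \<in> iterated_join M T P n" unfolding iterated_join_def by blast
    qed
  qed
  moreover have "(\<Sum>A\<in>?C ` ?S. prob A * ln (prob A)) = (\<Sum>a\<in>?S. prob (?C a) * ln (prob (?C a)))"
    proof (subst sum.reindex_nontrivial[OF finS])
    fix a b assume "a \<noteq> b" "?C a = ?C b"
    then have "?C a = {}" by blast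
    then show "prob (?C a) * ln (prob (?C a)) = 0" by (metis measure_empty mult_zero_left)
  qed simp
  moreover have "\<dots> = (\<Sum>a\<in>itinerary T P n ` space M. prob (?C a) * ln (prob (?C a)))"
  proof (rule sum.mono_neutral_right[OF finS im], rule ballI)
    fix a assume "a \<in> ?S - itinerary T P n ` space M"
    then have "?C a = {}" by blast
    then show "prob (?C a) * ln (prob (?C a)) = 0" by (metis measure_empty mult_zero_left)
  qed
  moreover have "ent M (itinerary T P n) = (\<Sum>a\<in>itinerary T P n ` space M. prob (?C a) * - ln (prob (?C a)))"
    unfolding ent_def
    by (rule expectation_simple_function[OF simple_function_itinerary, of "\<lambda>a. - ln (prob (?C a))"])
  ultimately show ?thesis unfolding partition_entropy_def by (simp add: sum_negf)
qed

lemma entropy_rate_tendsto: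
  "(\<lambda>n. ent M (itinerary T P n) / real n) \<longlonglongrightarrow> entropy_rate M T P"
proof -
  have "ent M (itinerary T P (m + n)) \<le> ent M (itinerary T P m) + ent M (itinerary T P n)" for m n
  proof -
    let ?V = "\<lambda>x. itinerary T P n ((T ^^ m) x)"
    have V: "simple_function M ?V"
      by (rule simple_function_comp[OF T_funpow_measurable simple_function_itinerary])
    have "ent M (itinerary T P (m + n)) = ent M (\<lambda>x. case (itinerary T P m x, ?V x) of (u, v) \<Rightarrow> u @ v)"
      by (simp add: itinerary_add[abs_def])
    also have "\<dots> \<le> ent M (\<lambda>x. (itinerary T P m x, ?V x))"
      by (rule ent_mono) (intro simple_function_Pair simple_function_itinerary V)
    also have "\<dots> \<le> ent M (itinerary T P m) + ent M ?V"
      by (rule ent_Pair_le[OF simple_function_itinerary V])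
    also have "ent M ?V = ent M (itinerary T P n)"
      by (rule ent_comp_measure_preserving[OF simple_function_itinerary T_funpow_measurable distr_T_funpow])
    finally show ?thesis .
  qed
  from subadditive_tendsto[of "\<lambda>n. ent M (itinerary T P n)", OF ent_nonneg this]
  obtain l where l: "(\<lambda>n. ent M (itinerary T P n) / real n) \<longlonglongrightarrow> l" ..
  have "entropy_rate M T P = l"
    unfolding entropy_rate_def partition_entropy_eq_ent by (rule limI[OF l])
  with l show ?thesis by simp
qed

end

end

section \<open>Blocks of the full shift and approximation by cylinder sets\<close>

definition full_shift :: "nat \<Rightarrow> (int \<Rightarrow> nat) set" where
  "full_shift D = {x. range x \<subseteq> {..D}}"

definition words :: "nat \<Rightarrow> nat \<Rightarrow> nat list set" where
  "words D n = {w. set w \<subseteq> {..D} \<and> length w = n}"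

definition block :: "int \<Rightarrow> nat \<Rightarrow> (int \<Rightarrow> nat) \<Rightarrow> nat list" where
  "block a n x = map (\<lambda>i. x (a + int i)) [0..<n]"

lemma finite_words: "finite (words D n)"
  unfolding words_def by (rule finite_lists_length_eq) simp

lemma length_block [simp]: "length (block a n x) = n"
  by (simp add: block_def)

lemma nth_block: "i < n \<Longrightarrow> block a n x ! i = x (a + int i)"
  by (simp add: block_def)

lemma take_drop_block: "i + m \<le> n \<Longrightarrow> take m (drop i (block a n x)) = block (a + int i) m x"
  by (rule nth_equalityI) (auto simp: nth_block add.assoc)

lemma block_in_words: "x \<in> full_shift D \<Longrightarrow> block a n x \<in> words D n"
  by (auto simp: block_def words_def full_shift_def)

lemma shift_funpow: "(shift_map ^^ n) x = (\<lambda>i. x (i + int n))"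
  by (induction n arbitrary: x) (auto simp: shift_map_def fun_eq_iff algebra_simps)

lemma block_shift: "block a n ((shift_map ^^ m) x) = block (a + int m) n x"
  by (simp add: block_def shift_funpow algebra_simps)

lemma shift_of_finite_type_full_shift: "shift_of_finite_type (full_shift D)"
  unfolding shift_of_finite_type_def
proof
  show "full_shift D \<noteq> {}" unfolding full_shift_def by (auto intro!: exI[of _ "\<lambda>_. 0"])
  show "\<exists>\<Lambda> W. finite \<Lambda> \<and> finite W \<and> full_shift D =
      {x. range x \<subseteq> \<Lambda> \<and> (\<forall>w\<in>W. \<forall>i. \<not> occurs_at w x i)}"
    by (rule exI[of _ "{..D}"], rule exI[of _ "{}"]) (simp add: full_shift_def)
qed

lemma coordinate_measurable:
  "(\<lambda>x. x j) \<in> measurable (borel :: (int \<Rightarrow> nat) measure) (count_space UNIV)"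
proof -
  have "(\<lambda>x. x j) \<in> borel_measurable (borel :: (int \<Rightarrow> nat) measure)"
    by (rule borel_measurable_continuous_onI) (rule continuous_on_product_coordinates)
  then show ?thesis
    using measurable_cong_sets[OF refl sets_borel_eq_count_space] by blast
qed

locale invariant_full_shift_measure =
  fixes D :: nat and M :: "(int \<Rightarrow> nat) measure"
  assumes invariant: "M \<in> invariant_measures (full_shift D)"

sublocale invariant_full_shift_measure \<subseteq> measure_preserving M shift_map
proof -
  interpret prob_space M using invariant by (simp add: invariant_measures_def)
  show "measure_preserving M shift_map"
    by unfold_locales (use invariant in \<open>simp_all add: invariant_measures_def\<close>)
qed

context invariant_full_shift_measure
begin

lemma sets_M: "sets M = sets (restrict_space borel (full_shift D))"
  using invariant by (simp add: invariant_measures_def)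

lemma space_M: "space M = full_shift D"
  using sets_eq_imp_space_eq[OF sets_M] by (simp add: space_restrict_space)

lemma simple_function_coordinate: "simple_function M (\<lambda>x. x j)"
  unfolding simple_function_def
proof
  show "finite ((\<lambda>x. x j) ` space M)"
    by (rule finite_subset[of _ "{..D}"]) (auto simp: space_M full_shift_def)
  have "(\<lambda>x. x j) \<in> measurable (restrict_space borel (full_shift D)) (count_space UNIV)"
    by (rule measurable_restrict_space1[OF coordinate_measurable])
  then have "(\<lambda>x. x j) \<in> measurable M (count_space UNIV)"
    using measurable_cong_sets[OF sets_M refl] by blast
  then show "\<forall>c\<in>(\<lambda>x. x j) ` space M. (\<lambda>x. x j) -` {c} \<inter> space M \<in> sets M"
    by (auto intro: measurable_sets)
qed

lemma simple_function_block: "simple_function M (block a n)"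
  unfolding block_def by (rule simple_function_map_upt[OF simple_function_coordinate])

definition cylinder_set :: "nat \<Rightarrow> (int \<Rightarrow> nat) set \<Rightarrow> bool" where
  "cylinder_set k B \<longleftrightarrow> (\<exists>S. B = {x \<in> space M. block (- int k) (2 * k + 1) x \<in> S})"

lemma cylinder_set_sets: "cylinder_set k B \<Longrightarrow> B \<in> sets M"
  unfolding cylinder_set_def
  using simple_functionD(2)[OF simple_function_block] by (force simp: vimage_def Int_def conj_commute)

lemma cylinder_set_mono:
  assumes "cylinder_set k B" "k \<le> l"
  shows "cylinder_set l B"
proof -
  obtain S where "B = {x \<in> space M. block (- int k) (2 * k + 1) x \<in> S}"
    using assms(1) unfolding cylinder_set_def by blast
  moreover have "block (- int k) (2 * k + 1) x = take (2 * k + 1) (drop (l - k) (block (- int l) (2 * l + 1) x))" for x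
    using assms(2) by (subst take_drop_block) (auto simp: of_nat_diff)
  ultimately have "B = {x \<in> space M. block (- int l) (2 * l + 1) x \<in> {w. take (2 * k + 1) (drop (l - k) w) \<in> S}}"
    by simp
  then show ?thesis unfolding cylinder_set_def by blast
qed

lemma cylinder_set_compl: "cylinder_set k B \<Longrightarrow> cylinder_set k (space M - B)"
  unfolding cylinder_set_def
proof (elim exE)
  fix S assume "B = {x \<in> space M. block (- int k) (2 * k + 1) x \<in> S}"
  then show "\<exists>S. space M - B = {x \<in> space M. block (- int k) (2 * k + 1) x \<in> S}"
    by (intro exI[of _ "- S"]) auto
qed

lemma cylinder_set_UN:
  assumes "\<And>i. i \<in> I \<Longrightarrow> cylinder_set k (B i)"
  shows "cylinder_set k (\<Union>i\<in>I. B i)"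
proof -
  obtain S where S: "\<And>i. i \<in> I \<Longrightarrow> B i = {x \<in> space M. block (- int k) (2 * k + 1) x \<in> S i}"
    using assms unfolding cylinder_set_def by metis
  then have "(\<Union>i\<in>I. B i) = {x \<in> space M. block (- int k) (2 * k + 1) x \<in> (\<Union>i\<in>I. S i)}" by auto
  then show ?thesis unfolding cylinder_set_def by blast
qed

text \<open>
  Cylinder sets over finitely many windows can be written over one window containing them all.
\<close>

lemma ex_common_window:
  fixes I :: "'i set"
  assumes "finite I" "\<And>i. i \<in> I \<Longrightarrow> \<exists>k B. cylinder_set k B \<and> Q i B"
  shows "\<exists>k B. \<forall>i\<in>I. cylinder_set k (B i) \<and> Q i (B i)"
proof -
  obtain k B where kB: "\<And>i. i \<in> I \<Longrightarrow> cylinder_set (k i) (B i) \<and> Q i (B i)"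
    using assms(2) by metis
  have "k i \<le> sum k I" if "i \<in> I" for i
    using assms(1) that by (intro member_le_sum) auto
  with kB have "\<forall>i\<in>I. cylinder_set (sum k I) (B i) \<and> Q i (B i)"
    using cylinder_set_mono by blast
  then show ?thesis by blast
qed

text \<open>
  The sets that can be approximated by cylinder sets form a sigma-algebra containing the preimages
  under the coordinates. A countable union is first replaced by a finite one, at the price \<open>e / 2\<close>.
\<close>

lemma cylinder_approximation_borel:
  assumes "A \<in> sigma_sets UNIV {{f. f i \<in> A} | (i::int) A. A \<in> sets (borel :: nat measure)}"
  shows "A \<in> sets borel \<and>
    (\<forall>e>0. \<exists>k B. cylinder_set k B \<and> prob ((space M \<inter> A - B) \<union> (B - A)) < e)"
  using assms
proof (induction rule: sigma_sets.induct)
  case (Basic a)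
  then obtain i A where a: "a = {f :: int \<Rightarrow> nat. f i \<in> A}" by auto
  have "(\<lambda>x. x i) -` A \<inter> space borel \<in> sets (borel :: (int \<Rightarrow> nat) measure)"
    by (rule measurable_sets[OF coordinate_measurable]) simp
  then have "a \<in> sets borel" using a by (simp add: vimage_def)
  define k where "k = nat \<bar>i\<bar>"
  have "cylinder_set k (space M \<inter> a)"
    unfolding cylinder_set_def
  proof (rule exI[of _ "{w. w ! nat (i + int k) \<in> A}"])
    have "block (- int k) (2 * k + 1) x ! nat (i + int k) = x i" for x
      by (subst nth_block) (auto simp: k_def)
    then show "space M \<inter> a = {x \<in> space M. block (- int k) (2 * k + 1) x \<in> {w. w ! nat (i + int k) \<in> A}}"
      using a by auto
  qed
  moreover have "(space M \<inter> a - space M \<inter> a) \<union> (space M \<inter> a - a) = {}" by auto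
  ultimately show ?case using \<open>a \<in> sets borel\<close> by (metis measure_empty)
next
  case Empty
  have "cylinder_set 0 {}" unfolding cylinder_set_def by (rule exI[of _ "{}"]) simp
  then show ?case by (metis Diff_empty Int_empty_right Un_empty measure_empty sets.empty_sets)
next
  case (Compl a)
  show ?case
  proof (intro conjI allI impI)
    show "UNIV - a \<in> sets borel" using Compl by auto
    fix e :: real assume "0 < e"
    then obtain k B where B: "cylinder_set k B" "prob ((space M \<inter> a - B) \<union> (B - a)) < e"
      using Compl by blast
    have sub: "B \<subseteq> space M" using cylinder_set_sets[OF B(1)] sets.sets_into_space by blast
    then have "(space M \<inter> (UNIV - a) - (space M - B)) \<union> ((space M - B) - (UNIV - a)) = (space M \<inter> a - B) \<union> (B - a)"
      by auto
    with B show "\<exists>k B. cylinder_set k B \<and> prob ((space M \<inter> (UNIV - a) - B) \<union> (B - (UNIV - a))) < e"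
      using cylinder_set_compl[OF B(1)] by metis
  qed
next
  case (Union a)
  have in_sets: "space M \<inter> a i \<in> sets M" for i
    using Union.IH unfolding sets_M space_M sets_restrict_space by auto
  show ?case
  proof (intro conjI allI impI)
    show "(\<Union>i. a i) \<in> sets borel" using Union.IH by auto
    fix e :: real assume e: "0 < e"
    let ?F = "\<lambda>m. \<Union>i<m. space M \<inter> a i"
    have F_sets: "?F m \<in> sets M" for m
      by (rule sets.finite_UN) (use in_sets in simp_all)
    have "(\<lambda>m. prob (?F m)) \<longlonglongrightarrow> prob (\<Union>m. ?F m)"
    proof (rule finite_Lim_measure_incseq)
      show "range ?F \<subseteq> sets M" using F_sets by blast
      have "?F m \<subseteq> ?F (Suc m)" for m by (rule UN_mono) simp_all
      then show "incseq ?F" by (rule incseq_SucI)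
    qed
    moreover have "(\<Union>m. ?F m) = space M \<inter> (\<Union>i. a i)" by auto
    ultimately have "eventually (\<lambda>m. prob (space M \<inter> (\<Union>i. a i)) - e / 2 < prob (?F m)) sequentially"
      using e by (intro order_tendstoD(1)) auto
    then obtain m where m: "prob (space M \<inter> (\<Union>i. a i)) - e / 2 < prob (?F m)"
      unfolding eventually_sequentially by blast
    have "\<exists>k B. \<forall>i\<in>{..<m}. cylinder_set k (B i) \<and>
        prob ((space M \<inter> a i - B i) \<union> (B i - a i)) < e / (2 * (real m + 1))"
      by (rule ex_common_window) (use Union.IH e in auto)
    then obtain k B where B: "\<And>i. i < m \<Longrightarrow> cylinder_set k (B i)"
      "\<And>i. i < m \<Longrightarrow> prob ((space M \<inter> a i - B i) \<union> (B i - a i)) < e / (2 * (real m + 1))"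
      by blast
    have cyl: "cylinder_set k (\<Union>i<m. B i)" using B(1) by (intro cylinder_set_UN) auto
    have B_sets: "B i \<in> sets M" "B i \<subseteq> space M" if "i < m" for i
      using cylinder_set_sets[OF B(1)[OF that]] sets.sets_into_space by auto
    have diff_sets: "(space M \<inter> a i - B i) \<union> (B i - a i) \<in> sets M" if "i < m" for i
    proof -
      have "B i - a i = B i - (space M \<inter> a i)" using B_sets(2)[OF that] by auto
      then show ?thesis using in_sets B_sets(1)[OF that] by (metis sets.Diff sets.Un)
    qed
    let ?A = "space M \<inter> (\<Union>i. a i)" and ?G = "\<Union>i<m. (space M \<inter> a i - B i) \<union> (B i - a i)"
    have "?A = (\<Union>i. space M \<inter> a i)" by blast
    also have "\<dots> \<in> sets M" by (rule sets.countable_UN) (use in_sets in blast)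
    finally have A_sets: "?A \<in> sets M" .
    have G_sets: "?G \<in> sets M" by (rule sets.finite_UN) (use diff_sets in simp_all)
    have "(?A - (\<Union>i<m. B i)) \<union> ((\<Union>i<m. B i) - (\<Union>i. a i)) \<subseteq> (?A - ?F m) \<union> ?G"
      by blast
    then have "prob ((?A - (\<Union>i<m. B i)) \<union> ((\<Union>i<m. B i) - (\<Union>i. a i))) \<le> prob ((?A - ?F m) \<union> ?G)"
      by (rule finite_measure_mono) (intro sets.Un sets.Diff A_sets F_sets G_sets)
    also have "\<dots> \<le> prob (?A - ?F m) + prob ?G"
      by (rule measure_Un_le) (intro sets.Diff A_sets F_sets G_sets)+
    also have "prob (?A - ?F m) = prob ?A - prob (?F m)"
      by (rule finite_measure_Diff[OF A_sets F_sets]) blast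
    also have "\<dots> < e / 2" using m by simp
    also have "prob ?G \<le> (\<Sum>i<m. prob ((space M \<inter> a i - B i) \<union> (B i - a i)))"
      by (rule measure_UNION_le) (use diff_sets in simp_all)
    also have "\<dots> \<le> (\<Sum>i<m. e / (2 * (real m + 1)))"
      using B(2) by (intro sum_mono less_imp_le) auto
    also have "\<dots> \<le> e / 2" using e by (simp add: field_simps)
    finally show "\<exists>k B. cylinder_set k B \<and> prob ((space M \<inter> (\<Union>i. a i) - B) \<union> (B - (\<Union>i. a i))) < e"
      using cyl by auto
  qed
qed

lemma cylinder_approximation:
  assumes "A \<in> sets M" "0 < e"
  shows "\<exists>k B. cylinder_set k B \<and> prob ((A - B) \<union> (B - A)) < e"
proof -
  obtain A' where A': "A = full_shift D \<inter> A'" "A' \<in> sets borel"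
    using assms(1) unfolding sets_M sets_restrict_space by auto
  have "A' \<in> sets (Pi\<^sub>M (UNIV :: int set) (\<lambda>_. borel :: nat measure))"
    using A'(2) by (simp add: sets_PiM_equal_borel)
  then have "A' \<in> sigma_sets UNIV {{f. f i \<in> A} | (i::int) A. A \<in> sets (borel :: nat measure)}"
    unfolding sets_PiM_single by (simp add: PiE_UNIV_domain)
  with cylinder_approximation_borel assms(2) obtain k B
    where B: "cylinder_set k B" "prob ((space M \<inter> A' - B) \<union> (B - A')) < e" by blast
  moreover have "B \<subseteq> space M" using cylinder_set_sets[OF B(1)] sets.sets_into_space by blast
  ultimately have "(space M \<inter> A' - B) \<union> (B - A') = (A - B) \<union> (B - A)" using A'(1) space_M by auto
  with B show ?thesis by metis
qed

text \<open>
  Approximate each cell by a cylinder set and predict a cell whose cylinder set contains the point. The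
  prediction is correct unless the point is in one of the symmetric differences.
\<close>

lemma cell_approximation:
  assumes P: "finite P" "P \<subseteq> sets M" "partition_on (space M) P" and "0 < e"
  shows "\<exists>k g. \<P>(x in M. cell P x \<noteq> g (block (- int k) (2 * k + 1) x)) < e"
proof -
  let ?e = "e / (real (card P) + 1)"
  have "\<exists>k B. \<forall>A\<in>P. cylinder_set k (B A) \<and> prob ((A - B A) \<union> (B A - A)) < ?e"
    using P(1) by (rule ex_common_window) (use cylinder_approximation P(2) \<open>0 < e\<close> in \<open>auto simp: subset_iff\<close>)
  then obtain k B where B: "\<And>A. A \<in> P \<Longrightarrow> cylinder_set k (B A)" "\<And>A. A \<in> P \<Longrightarrow> prob ((A - B A) \<union> (B A - A)) < ?e"
    by blast
  then obtain S where S: "\<And>A. A \<in> P \<Longrightarrow> B A = {x \<in> space M. block (- int k) (2 * k + 1) x \<in> S A}"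
    unfolding cylinder_set_def by metis
  define g where "g w = (SOME A. A \<in> P \<and> w \<in> S A)" for w
  have diff_sets: "(A - B A) \<union> (B A - A) \<in> sets M" if "A \<in> P" for A
    using cylinder_set_sets[OF B(1)[OF that]] P(2) that by auto
  have "{x \<in> space M. cell P x \<noteq> g (block (- int k) (2 * k + 1) x)} \<subseteq> (\<Union>A\<in>P. (A - B A) \<union> (B A - A))"
  proof
    fix x assume "x \<in> {x \<in> space M. cell P x \<noteq> g (block (- int k) (2 * k + 1) x)}"
    then have x: "x \<in> space M" "cell P x \<noteq> g (block (- int k) (2 * k + 1) x)" by auto
    show "x \<in> (\<Union>A\<in>P. (A - B A) \<union> (B A - A))"
    proof (rule ccontr)
      assume "x \<notin> (\<Union>A\<in>P. (A - B A) \<union> (B A - A))"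
      then have "\<And>A. A \<in> P \<Longrightarrow> block (- int k) (2 * k + 1) x \<in> S A \<longleftrightarrow> x \<in> A"
        using S x(1) by blast
      then have "\<And>A. A \<in> P \<and> block (- int k) (2 * k + 1) x \<in> S A \<longleftrightarrow> A = cell P x"
        using cell_eq_iff[OF P(3) _ x(1)] cell_mem(1)[OF P(3) x(1)] by blast
      then have "g (block (- int k) (2 * k + 1) x) = cell P x" unfolding g_def by simp
      with x(2) show False by simp
    qed
  qed
  then have "\<P>(x in M. cell P x \<noteq> g (block (- int k) (2 * k + 1) x)) \<le> prob (\<Union>A\<in>P. (A - B A) \<union> (B A - A))"
    using diff_sets P(1) by (intro finite_measure_mono sets.finite_UN) auto
  also have "\<dots> \<le> (\<Sum>A\<in>P. prob ((A - B A) \<union> (B A - A)))"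
    using diff_sets P(1) by (intro measure_UNION_le) auto
  also have "\<dots> \<le> (\<Sum>A\<in>P. ?e)" using B(2) by (intro sum_mono less_imp_le) auto
  also have "\<dots> < e" using \<open>0 < e\<close> by (simp add: field_simps)
  finally show ?thesis by blast
qed

end

section \<open>Pressure is bounded by partition functions\<close>

text \<open>
  The total mass of a word code whose letters are encoded independently of each other.
\<close>

lemma sum_prod_lists_le_1:
  fixes f :: "nat \<Rightarrow> 'a \<Rightarrow> real"
  assumes "finite P" "\<And>i b. 0 \<le> f i b" "\<And>i. (\<Sum>b\<in>P. f i b) \<le> 1"
  shows "(\<Sum>a | set a \<subseteq> P \<and> length a = n. \<Prod>i<n. f i (a ! i)) \<le> 1"
  using assms(2,3)
proof (induction n arbitrary: f)
  case 0
  have "{a. set a \<subseteq> P \<and> length a = 0} = {[]}" by auto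
  then show ?case by simp
next
  case (Suc n)
  let ?L = "\<lambda>n. {a. set a \<subseteq> P \<and> length a = n}"
  have bij: "bij_betw (\<lambda>(b, a). b # a) (P \<times> ?L n) (?L (Suc n))"
    by (rule bij_betwI[where g = "\<lambda>a. (hd a, tl a)"]) (auto simp: length_Suc_conv)
  have "(\<Sum>a\<in>?L (Suc n). \<Prod>i<Suc n. f i (a ! i))
      = (\<Sum>(b, a)\<in>P \<times> ?L n. \<Prod>i<Suc n. f i ((b # a) ! i))"
    using sum.reindex_bij_betw[OF bij, of "\<lambda>a. \<Prod>i<Suc n. f i (a ! i)"] by (simp add: case_prod_beta)
  also have "\<dots> = (\<Sum>b\<in>P. f 0 b) * (\<Sum>a\<in>?L n. \<Prod>i<n. f (Suc i) (a ! i))"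
    by (simp del: prod.lessThan_Suc add: prod.lessThan_Suc_shift sum.cartesian_product[symmetric] sum_product)
  also have "\<dots> \<le> 1 * 1"
    using Suc.prems by (intro mult_mono Suc.IH sum_nonneg prod_nonneg) auto
  finally show ?case by simp
qed

context invariant_full_shift_measure
begin

lemma expectation_shift:
  fixes h :: "(int \<Rightarrow> nat) \<Rightarrow> real"
  assumes "simple_function M h"
  shows "(\<integral>x. h ((shift_map ^^ n) x) \<partial>M) = (\<integral>x. h x \<partial>M)"
  using integral_distr[OF T_funpow_measurable, of h n] integrable_simple_function[OF assms]
  by (simp add: distr_T_funpow borel_measurable_integrable)

text \<open>
  Let \<open>g\<close> predict the cell of a point from the letters in a window of radius \<open>k\<close> with error probability
  below \<open>d\<close>. The pair of a block \<open>w\<close> and an itinerary \<open>a\<close> is encoded by the Gibbs weight of \<open>w\<close>, normalised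
  by the bound on the partition function, times a factor \<open>1 - d\<close> for each correct prediction and \<open>d / r\<close>
  for each wrong one, \<open>r\<close> being the number of cells. Integrating the code length gives the bound with an
  error of \<open>d * ln (r / d) - ln (1 - d)\<close> per letter, which vanishes as \<open>d\<close> tends to 0.
\<close>

lemma entropy_rate_le:
  fixes \<psi> :: "nat list \<Rightarrow> real"
  assumes P: "finite P" "P \<subseteq> sets M" "partition_on (space M) P"
    and Z: "\<And>n. (\<Sum>w\<in>words D (n + N). exp (\<Sum>i<n. \<psi> (take N (drop i w)))) \<le> C * exp (real n * p)"
    and N: "0 < N"
  shows "entropy_rate M shift_map P \<le> p - (\<integral>x. \<psi> (block 0 N x) \<partial>M)"
proof -
  define I where "I = (\<integral>x. \<psi> (block 0 N x) \<partial>M)"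
  define r where "r = real (card P)"
  have "space M \<noteq> {}" by (rule not_empty)
  then have "P \<noteq> {}" using P(3) by (auto simp: partition_on_def)
  then have r: "1 \<le> r" using P(1) by (simp add: r_def Suc_le_eq card_gt_0_iff)
  have C: "0 < C"
  proof -
    have "replicate N 0 \<in> words D (0 + N)" by (auto simp: words_def)
    then have "0 < (\<Sum>w\<in>words D (0 + N). exp (\<Sum>i<0. \<psi> (take N (drop i w))))"
      using finite_words by (intro sum_pos) auto
    then show ?thesis using Z[of 0] by simp
  qed
  have bound: "entropy_rate M shift_map P \<le> p - I + (d * ln (r / d) - ln (1 - d))"
    if d: "0 < d" "d < 1" for d
  proof -
    obtain k g where kg: "\<P>(x in M. cell P x \<noteq> g (block (- int k) (2 * k + 1) x)) < d"
      using cell_approximation[OF P d(1)] by blast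
    define err where "err x \<longleftrightarrow> cell P x \<noteq> g (block (- int k) (2 * k + 1) x)" for x
    define cost where "cost x = (if err x then ln (r / d) else - ln (1 - d))" for x
    have simple_err: "simple_function M err"
      unfolding err_def[abs_def]
      by (rule simple_function_compose2[OF simple_function_cell[OF P] simple_function_block])
    have simple_cost: "simple_function M cost"
      unfolding cost_def[abs_def] by (rule simple_function_compose1[OF simple_err])
    have cost_le: "(\<integral>x. cost x \<partial>M) \<le> d * ln (r / d) - ln (1 - d)"
    proof -
      have ev: "{x \<in> space M. err x} \<in> sets M"
        using simple_function_event[OF simple_err, of True] by simp
      have "(\<integral>x. cost x \<partial>M) \<le> (\<integral>x. indicator {x \<in> space M. err x} x * ln (r / d) - ln (1 - d) \<partial>M)"
      proof (rule integral_mono[OF integrable_simple_function[OF simple_cost]])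
        show "integrable M (\<lambda>x. indicator {x \<in> space M. err x} x * ln (r / d) - ln (1 - d))"
          using ev by (auto simp: emeasure_eq_measure)
      qed (use d r in \<open>auto simp: cost_def indicator_def\<close>)
      also have "\<dots> = prob {x \<in> space M. err x} * ln (r / d) - ln (1 - d)"
        using ev by (subst Bochner_Integration.integral_diff) (auto simp: emeasure_eq_measure prob_space)
      also have "\<dots> \<le> d * ln (r / d) - ln (1 - d)"
        using kg d r unfolding err_def by (intro diff_right_mono mult_right_mono) auto
      finally show ?thesis .
    qed
    have ent_le: "ent M (itinerary shift_map P n) \<le>
        ln C + real (n + 2 * k) * (p - I) + real n * (d * ln (r / d) - ln (1 - d))" for n
    proof -
      \<comment> \<open>The itinerary is started at time \<open>k\<close>, so that the windows of all its \<open>n\<close> entries lie in the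
         block with coordinates \<open>0, \<dots>, n + 2 * k\<close>; by invariance its entropy does not change.\<close>
      define n' where "n' = n + 2 * k"
      define S where "S w = (\<Sum>i<n'. \<psi> (take N (drop i w)))" for w
      define V where "V x = (block 0 (n' + N) x, itinerary shift_map P n ((shift_map ^^ k) x))" for x
      define f where "f w i A = (if A = g (take (2 * k + 1) (drop i w)) then 1 - d else d / r)" for w i A
      define q where "q = (\<lambda>(w, a). exp (S w) / (C * exp (real n' * p)) * (\<Prod>i<n. f w i (a ! i)))"
      let ?L = "{a. set a \<subseteq> P \<and> length a = n}"
      have f_pos: "0 < f w i A" for w i A using d r by (auto simp: f_def)
      have f_sum: "(\<Sum>A\<in>P. f w i A) \<le> 1" for w i
      proof -
        have "(\<Sum>A\<in>P. f w i A) \<le> (\<Sum>A\<in>P. (if A = g (take (2 * k + 1) (drop i w)) then 1 - d else 0) + d / r)"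
          using d r by (intro sum_mono) (auto simp: f_def)
        also have "\<dots> = (\<Sum>A\<in>P. (if A = g (take (2 * k + 1) (drop i w)) then 1 - d else 0)) + d"
          using r by (simp add: sum.distrib r_def)
        also have "\<dots> \<le> 1" using d P(1) by simp
        finally show ?thesis .
      qed
      have q_pos: "0 < q v" for v
        using C f_pos by (simp add: q_def case_prod_beta divide_pos_pos mult_pos_pos prod_pos)
      have V_simple: "simple_function M V"
        unfolding V_def
        by (intro simple_function_Pair simple_function_block
            simple_function_comp[OF T_funpow_measurable simple_function_itinerary[OF P]])
      have "ent M (itinerary shift_map P n) = ent M (\<lambda>x. itinerary shift_map P n ((shift_map ^^ k) x))"
        by (rule ent_comp_measure_preserving[symmetric, OF simple_function_itinerary[OF P] T_funpow_measurable distr_T_funpow])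
      also have "\<dots> = ent M (\<lambda>x. snd (V x))" by (simp add: V_def)
      also have "\<dots> \<le> ent M V" by (rule ent_mono[OF V_simple])
      also have "\<dots> \<le> (\<integral>x. - ln (q (V x)) \<partial>M)"
      proof (rule ent_le_cross_entropy[OF V_simple])
        show "finite (words D (n' + N) \<times> ?L)"
          using finite_words finite_lists_length_eq[OF P(1)] by auto
        have "itinerary shift_map P n x \<in> ?L" if "x \<in> space M" for x
          unfolding itinerary_def using cell_mem(1)[OF P(3) T_funpow_space[OF that]] by auto
        then show "V ` space M \<subseteq> words D (n' + N) \<times> ?L"
          using T_funpow_space block_in_words by (auto simp: V_def space_M)
        have "(\<Sum>v\<in>words D (n' + N) \<times> ?L. q v)
            = (\<Sum>w\<in>words D (n' + N). exp (S w) / (C * exp (real n' * p)) * (\<Sum>a\<in>?L. \<Prod>i<n. f w i (a ! i)))"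
          unfolding q_def sum.cartesian_product[symmetric] by (simp add: sum_distrib_left)
        also have "\<dots> \<le> (\<Sum>w\<in>words D (n' + N). exp (S w) / (C * exp (real n' * p)) * 1)"
          using C f_sum by (intro sum_mono mult_left_mono sum_prod_lists_le_1 P(1)) (auto intro: less_imp_le[OF f_pos])
        also have "\<dots> = (\<Sum>w\<in>words D (n' + N). exp (S w)) / (C * exp (real n' * p))"
          by (simp add: sum_divide_distrib)
        also have "\<dots> \<le> 1" using Z[of n'] C by (simp add: S_def)
        finally show "(\<Sum>v\<in>words D (n' + N) \<times> ?L. q v) \<le> 1" .
      qed (use q_pos in \<open>auto intro: less_imp_le\<close>)
      also have "(\<integral>x. - ln (q (V x)) \<partial>M) = (\<integral>x. (ln C + real n' * p) - (\<Sum>i<n'. \<psi> (block 0 N ((shift_map ^^ i) x)))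
          + (\<Sum>i<n. cost ((shift_map ^^ (i + k)) x)) \<partial>M)"
      proof (rule Bochner_Integration.integral_cong)
        fix x
        have S_eq: "S (block 0 (n' + N) x) = (\<Sum>i<n'. \<psi> (block 0 N ((shift_map ^^ i) x)))"
          unfolding S_def by (intro sum.cong) (auto simp: take_drop_block block_shift)
        have "f (block 0 (n' + N) x) i (itinerary shift_map P n ((shift_map ^^ k) x) ! i)
            = exp (- cost ((shift_map ^^ (i + k)) x))" if "i < n" for i
        proof -
          have "take (2 * k + 1) (drop i (block 0 (n' + N) x)) = block (- int k) (2 * k + 1) ((shift_map ^^ (i + k)) x)"
            using that N by (subst take_drop_block) (auto simp: n'_def block_shift)
          moreover have "itinerary shift_map P n ((shift_map ^^ k) x) ! i = cell P ((shift_map ^^ (i + k)) x)"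
            using that by (simp add: itinerary_def funpow_add)
          moreover have "exp (- ln (r / d)) = d / r" using d r by (simp add: exp_minus)
          ultimately show ?thesis using d by (simp add: f_def cost_def err_def)
        qed
        then have "(\<Prod>i<n. f (block 0 (n' + N) x) i (itinerary shift_map P n ((shift_map ^^ k) x) ! i))
            = exp (\<Sum>i<n. - cost ((shift_map ^^ (i + k)) x))"
          by (simp add: exp_sum)
        moreover have "C * exp (real n' * p) = exp (ln C + real n' * p)" using C by (simp add: exp_add)
        ultimately have "q (V x) = exp (S (block 0 (n' + N) x) - (ln C + real n' * p) + (\<Sum>i<n. - cost ((shift_map ^^ (i + k)) x)))"
          by (simp add: q_def V_def exp_add exp_diff)
        then show "- ln (q (V x)) = (ln C + real n' * p) - (\<Sum>i<n'. \<psi> (block 0 N ((shift_map ^^ i) x)))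
          + (\<Sum>i<n. cost ((shift_map ^^ (i + k)) x))"
          by (simp add: S_eq sum_negf)
      qed simp
      also have "\<dots> = (ln C + real n' * p) - (\<Sum>i<n'. I) + (\<Sum>i<n. (\<integral>x. cost x \<partial>M))"
      proof -
        have \<psi>: "simple_function M (\<lambda>x. \<psi> (block 0 N x))"
          by (rule simple_function_compose1[OF simple_function_block])
        have int1: "integrable M (\<lambda>x. \<psi> (block 0 N ((shift_map ^^ i) x)))" for i
          by (rule integrable_simple_function[OF simple_function_comp[OF T_funpow_measurable \<psi>]])
        have int2: "integrable M (\<lambda>x. cost ((shift_map ^^ i) x))" for i
          by (rule integrable_simple_function[OF simple_function_comp[OF T_funpow_measurable simple_cost]])
        show ?thesis
          using int1 int2
          by (simp add: expectation_shift[OF \<psi>] expectation_shift[OF simple_cost] prob_space I_def)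
      qed
      also have "\<dots> \<le> ln C + real n' * (p - I) + real n * (d * ln (r / d) - ln (1 - d))"
        using mult_left_mono[OF cost_le, of "real n"] by (simp add: algebra_simps)
      finally show ?thesis by (simp add: n'_def)
    qed
    have "(\<lambda>n. (ln C + real (n + 2 * k) * (p - I) + real n * (d * ln (r / d) - ln (1 - d))) / real n)
        \<longlonglongrightarrow> (p - I) + (d * ln (r / d) - ln (1 - d))"
      by real_asymp
    moreover have "\<forall>n. ent M (itinerary shift_map P n) / real n \<le>
        (ln C + real (n + 2 * k) * (p - I) + real n * (d * ln (r / d) - ln (1 - d))) / real n"
      using ent_le by (auto intro!: divide_right_mono)
    ultimately show ?thesis
      by (intro LIMSEQ_le[OF entropy_rate_tendsto[OF P]]) auto
  qed
  have "((\<lambda>d. p - I + (d * ln (r / d) - ln (1 - d))) \<longlongrightarrow> p - I) (at_right 0)"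
    using r by real_asymp
  moreover have "eventually (\<lambda>d. entropy_rate M shift_map P \<le> p - I + (d * ln (r / d) - ln (1 - d))) (at_right 0)"
    unfolding eventually_at_right_field by (rule exI[of _ 1]) (use bound in auto)
  ultimately show ?thesis
    unfolding I_def[symmetric] by (intro tendsto_lowerbound) auto
qed

end

lemma pressure_full_shift_le:
  fixes \<psi> :: "nat list \<Rightarrow> real"
  assumes Z: "\<And>n. (\<Sum>w\<in>words D (n + N). exp (\<Sum>i<n. \<psi> (take N (drop i w)))) \<le> C * exp (real n * p)"
    and N: "0 < N"
  shows "pressure (full_shift D) (\<lambda>x. \<psi> (block 0 N x)) \<le> ereal p"
  unfolding pressure_def
proof (rule SUP_least)
  fix M assume M: "M \<in> invariant_measures (full_shift D)"
  interpret invariant_full_shift_measure D M by unfold_locales (rule M)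
  have "KS_entropy M shift_map \<le> ereal (p - (\<integral>x. \<psi> (block 0 N x) \<partial>M))"
    unfolding KS_entropy_def
    by (rule SUP_least) (use entropy_rate_le[OF _ _ _ Z N] in auto)
  then have "KS_entropy M shift_map + ereal (\<integral>x. \<psi> (block 0 N x) \<partial>M)
      \<le> ereal (p - (\<integral>x. \<psi> (block 0 N x) \<partial>M)) + ereal (\<integral>x. \<psi> (block 0 N x) \<partial>M)"
    by (rule add_right_mono)
  then show "KS_entropy M shift_map + ereal (\<integral>x. \<psi> (block 0 N x) \<partial>M) \<le> ereal p" by simp
qed

section \<open>Potentials that reward marked words\<close>

text \<open>
  The letter 0 serves as a marker for the beginning of a word; its absence from the rest of the word makes
  occurrences of marked words disjoint.
\<close>

definition marked_words :: "nat \<Rightarrow> nat \<Rightarrow> nat list set" where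
  "marked_words D N = {w \<in> words D N. \<forall>i<N. w ! i = 0 \<longleftrightarrow> i = 0}"

text \<open>
  The bonus for a word in \<open>G\<close> is paid in full at its marker. It compensates the value \<open>-K\<close> at the remaining
  \<open>N - 1\<close> letters, so that the word as a whole contributes \<open>N * m w\<close>.
\<close>

definition word_potential :: "nat \<Rightarrow> real \<Rightarrow> nat list set \<Rightarrow> (nat list \<Rightarrow> real) \<Rightarrow> nat list \<Rightarrow> real" where
  "word_potential N K G m w = (if w \<in> G then real N * m w + (real N - 1) * K else - K)"

text \<open>
  Let \<open>Z n\<close> be the partition function for \<open>n\<close> letters. A block either starts with a word of \<open>G\<close> or pays
  \<open>exp (- t * K)\<close> for its first letter; hence \<open>Z (n + 1) \<le> (D + 1) * exp (- t * K) * Z n\<close> plus, for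
  \<open>n + 1 \<ge> N\<close>, the weight of the words of \<open>G\<close> times \<open>Z (n + 1 - N)\<close>. The hypothesis says that this
  recursion does not increase \<open>Z n * exp (- n * p)\<close>.
\<close>

lemma pressure_word_potential_le:
  assumes N: "0 < N" and G: "G \<subseteq> marked_words D N"
    and p: "(real D + 1) * exp (- t * K - p) + (\<Sum>w\<in>G. exp (real N * (t * m w - p))) \<le> 1"
  shows "pressure (full_shift D) (\<lambda>x. t * word_potential N K G m (block 0 N x)) \<le> ereal p"
proof -
  define \<psi> where "\<psi> w = t * word_potential N K G m w" for w
  define S where "S n w = (\<Sum>i<n. \<psi> (take N (drop i w)))" for n w
  define Z where "Z n = (\<Sum>w\<in>words D (n + N). exp (S n w))" for n
  define Y where "Y n = Z n * exp (- (real n * p))" for n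
  \<comment> \<open>The recursion for words of \<open>G\<close> starts at \<open>n = N\<close>; \<open>C\<close> bounds the initial values.\<close>
  define C where "C = (\<Sum>r<N. Y r)"
  have fin_G: "finite G" using G finite_words[of D N] unfolding marked_words_def by (auto intro: finite_subset)
  have Y_nonneg: "0 \<le> Y n" for n unfolding Y_def Z_def by (intro mult_nonneg_nonneg sum_nonneg) auto
  \<comment> \<open>Blocks that do not start with a word of \<open>G\<close>: remove the first letter.\<close>
  have bad: "(\<Sum>w | w \<in> words D (Suc n + N) \<and> take N w \<notin> G. exp (S (Suc n) w)) \<le> (real D + 1) * exp (- t * K) * Z n" for n
  proof -
    have "(\<Sum>w | w \<in> words D (Suc n + N) \<and> take N w \<notin> G. exp (S (Suc n) w))
        \<le> (\<Sum>(c, w)\<in>{..D} \<times> words D (n + N). exp (- t * K) * exp (S n w))"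
    proof (rule sum_le_included[where i = "\<lambda>(c, w). c # w"])
      show "\<forall>w\<in>{w. w \<in> words D (Suc n + N) \<and> take N w \<notin> G}. \<exists>y\<in>{..D} \<times> words D (n + N).
          (case y of (c, w) \<Rightarrow> c # w) = w \<and> exp (S (Suc n) w) \<le> (case y of (c, w) \<Rightarrow> exp (- t * K) * exp (S n w))"
      proof
        fix w assume w: "w \<in> {w. w \<in> words D (Suc n + N) \<and> take N w \<notin> G}"
        then obtain c v where cv: "w = c # v" by (cases w) (auto simp: words_def)
        have "S (Suc n) w = \<psi> (take N w) + S n v"
          unfolding S_def sum.lessThan_Suc_shift by (simp add: cv)
        also have "\<psi> (take N w) = - t * K" using w by (simp add: \<psi>_def word_potential_def)
        finally have "S (Suc n) w = - t * K + S n v" .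
        then show "\<exists>y\<in>{..D} \<times> words D (n + N). (case y of (c, w) \<Rightarrow> c # w) = w \<and>
            exp (S (Suc n) w) \<le> (case y of (c, w) \<Rightarrow> exp (- t * K) * exp (S n w))"
          using w cv by (intro bexI[of _ "(c, v)"]) (auto simp: words_def exp_add[symmetric])
      qed
    qed (use finite_words in \<open>auto intro: finite_subset\<close>)
    also have "\<dots> = (real D + 1) * exp (- t * K) * Z n"
      by (simp add: sum.cartesian_product[symmetric] Z_def sum_distrib_left[symmetric])
    finally show ?thesis .
  qed
  \<comment> \<open>Blocks that start with a word of \<open>G\<close>: remove this word. Each of its later positions contributes
     \<open>- t * K\<close>, because without a marker there no word of \<open>G\<close> starts at it.\<close>
  have good: "(\<Sum>w | w \<in> words D (n + N + N) \<and> take N w \<in> G. exp (S (n + N) w)) \<le> (\<Sum>u\<in>G. exp (real N * t * m u)) * Z n" for n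
  proof -
    have "(\<Sum>w | w \<in> words D (n + N + N) \<and> take N w \<in> G. exp (S (n + N) w))
        \<le> (\<Sum>(u, w)\<in>G \<times> words D (n + N). exp (real N * t * m u) * exp (S n w))"
    proof (rule sum_le_included[where i = "\<lambda>(u, w). u @ w"])
      show "\<forall>w\<in>{w. w \<in> words D (n + N + N) \<and> take N w \<in> G}. \<exists>y\<in>G \<times> words D (n + N).
          (case y of (u, w) \<Rightarrow> u @ w) = w \<and> exp (S (n + N) w) \<le> (case y of (u, w) \<Rightarrow> exp (real N * t * m u) * exp (S n w))"
      proof
        fix w assume w: "w \<in> {w. w \<in> words D (n + N + N) \<and> take N w \<in> G}"
        define u v where "u = take N w" and "v = drop N w"
        have uv: "w = u @ v" "u \<in> G" "v \<in> words D (n + N)"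
          using w by (auto simp: u_def v_def words_def dest: in_set_dropD)
        have u: "length u = N" "\<And>i. i < N \<Longrightarrow> u ! i = 0 \<longleftrightarrow> i = 0"
          using uv(2) G by (auto simp: marked_words_def words_def)
        have "take N (drop i w) \<notin> G" if "0 < i" "i < N" for i
        proof
          assume "take N (drop i w) \<in> G"
          then have "take N (drop i w) ! 0 = 0" using G N by (auto simp: marked_words_def)
          moreover have "take N (drop i w) ! 0 = u ! i"
            using that u(1) N by (simp add: uv(1) nth_append)
          ultimately show False using u(2)[of i] that by simp
        qed
        then have junk: "\<psi> (take N (drop i w)) = - t * K" if "i \<in> {0<..<N}" for i
          using that by (simp add: \<psi>_def word_potential_def)
        have "{..<N} = insert 0 {0<..<N}" using N by auto
        then have "(\<Sum>i<N. \<psi> (take N (drop i w))) = \<psi> (take N w) + (\<Sum>i\<in>{0<..<N}. - t * K)"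
          using junk by simp
        also have "\<dots> = real N * t * m u"
          using uv u(1) N by (simp add: \<psi>_def word_potential_def of_nat_diff algebra_simps)
        finally have first: "(\<Sum>i<N. \<psi> (take N (drop i w))) = real N * t * m u" .
        have "S (n + N) w = (\<Sum>i<N. \<psi> (take N (drop i w))) + (\<Sum>i<n. \<psi> (take N (drop (i + N) w)))"
          using sum.atLeastLessThan_concat[of 0 N "n + N" "\<lambda>i. \<psi> (take N (drop i w))"]
            sum.shift_bounds_nat_ivl[of "\<lambda>i. \<psi> (take N (drop i w))" 0 N n]
          by (simp add: S_def lessThan_atLeast0)
        also have "\<dots> = real N * t * m u + S n v"
          unfolding first S_def v_def by simp
        finally show "\<exists>y\<in>G \<times> words D (n + N).
          (case y of (u, w) \<Rightarrow> u @ w) = w \<and> exp (S (n + N) w) \<le> (case y of (u, w) \<Rightarrow> exp (real N * t * m u) * exp (S n w))"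
          using uv by (intro bexI[of _ "(u, v)"]) (auto simp: exp_add)
      qed
    qed (use finite_words fin_G in \<open>auto intro: finite_subset\<close>)
    also have "\<dots> = (\<Sum>u\<in>G. exp (real N * t * m u)) * Z n"
      by (simp add: sum.cartesian_product[symmetric] Z_def sum_product)
    finally show ?thesis .
  qed
  have Y_le: "Y n \<le> C" for n
  proof (induction n rule: less_induct)
    case (less n)
    show ?case
    proof (cases "n < N")
      case True
      then show ?thesis unfolding C_def by (intro member_le_sum) (auto simp: Y_nonneg)
    next
      case False
      then obtain l where l: "n = l + N" using le_Suc_ex[of N n] by (auto simp: add.commute)
      obtain k where k: "n = Suc k" using gr0_implies_Suc[of n] N l by (metis add_gr_0)
      have split: "words D (n + N) = {w. w \<in> words D (n + N) \<and> take N w \<notin> G} \<union> {w. w \<in> words D (n + N) \<and> take N w \<in> G}"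
        by auto
      have "Z n = (\<Sum>w | w \<in> words D (n + N) \<and> take N w \<notin> G. exp (S n w)) + (\<Sum>w | w \<in> words D (n + N) \<and> take N w \<in> G. exp (S n w))"
        unfolding Z_def by (subst split, rule sum.union_disjoint) (use finite_words[of D "n + N"] in \<open>auto intro: finite_subset\<close>)
      also have "\<dots> \<le> (real D + 1) * exp (- t * K) * Z k + (\<Sum>u\<in>G. exp (real N * t * m u)) * Z l"
        using bad[of k] good[of l] unfolding k[symmetric] l[symmetric] by simp
      finally have "Y n \<le> ((real D + 1) * exp (- t * K) * Z k + (\<Sum>u\<in>G. exp (real N * t * m u)) * Z l) * exp (- (real n * p))"
        unfolding Y_def by simp
      also have "\<dots> = (real D + 1) * exp (- t * K - p) * Y k + (\<Sum>u\<in>G. exp (real N * (t * m u - p))) * Y l"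
      proof -
        have 1: "exp (- (real n * p)) = exp (- p) * exp (- (real k * p))"
          unfolding k by (simp add: exp_add[symmetric] algebra_simps)
        have 2: "exp (- (real n * p)) = exp (- (real N * p)) * exp (- (real l * p))"
          unfolding l by (simp add: exp_add[symmetric] algebra_simps)
        have 3: "exp (real N * (t * m u - p)) = exp (real N * t * m u) * exp (- (real N * p))" for u
          by (simp add: exp_add[symmetric] algebra_simps)
        have 4: "exp (- t * K - p) = exp (- t * K) * exp (- p)"
          by (simp add: exp_add[symmetric])
        have "(real D + 1) * exp (- t * K) * Z k * exp (- (real n * p)) = (real D + 1) * exp (- t * K - p) * Y k"
          unfolding Y_def 1 4 by (simp only: ac_simps)
        moreover have "(\<Sum>u\<in>G. exp (real N * t * m u)) * Z l * exp (- (real n * p))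
            = (\<Sum>u\<in>G. exp (real N * (t * m u - p))) * Y l"
          unfolding Y_def 2 3 sum_distrib_right[symmetric] by (simp only: ac_simps)
        ultimately show ?thesis by (simp only: distrib_right)
      qed
      also have "\<dots> \<le> (real D + 1) * exp (- t * K - p) * C + (\<Sum>u\<in>G. exp (real N * (t * m u - p))) * C"
        using less.IH[of k] less.IH[of l] k l N
        by (intro add_mono mult_left_mono sum_nonneg) auto
      also have "\<dots> = ((real D + 1) * exp (- t * K - p) + (\<Sum>u\<in>G. exp (real N * (t * m u - p)))) * C"
        by (simp add: algebra_simps)
      also have "\<dots> \<le> 1 * C"
        using p Y_nonneg unfolding C_def by (intro mult_right_mono sum_nonneg)
      finally show ?thesis by simp
    qed
  qed
  have "(\<Sum>w\<in>words D (n + N). exp (\<Sum>i<n. \<psi> (take N (drop i w)))) \<le> C * exp (real n * p)" for n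
  proof -
    have "Z n = Y n * exp (real n * p)" by (simp add: Y_def exp_minus)
    also have "\<dots> \<le> C * exp (real n * p)" using Y_le by simp
    finally show ?thesis by (simp add: Z_def S_def)
  qed
  from pressure_full_shift_le[OF this N] show ?thesis by (simp add: \<psi>_def)
qed

section \<open>Random concatenations of words\<close>

text \<open>
  The process of independent, uniformly distributed words of \<open>W\<close>, written one after the other. For
  stationarity the coordinate 0 is placed uniformly at one of the \<open>N\<close> positions in its word.
\<close>

locale block_code =
  fixes D N :: nat and W :: "nat list set"
  assumes N_pos: "0 < N" and W_words: "W \<subseteq> words D N" and W_nonempty: "W \<noteq> {}"
begin

lemma finite_W: "finite W"
  using W_words finite_words finite_subset by blast

definition offsets :: "nat measure" where
  "offsets = uniform_count_measure {..<N}"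

definition blocks :: "(int \<Rightarrow> nat list) measure" where
  "blocks = Pi\<^sub>M UNIV (\<lambda>_. uniform_count_measure W)"

definition concat_blocks :: "nat \<times> (int \<Rightarrow> nat list) \<Rightarrow> int \<Rightarrow> nat" where
  "concat_blocks = (\<lambda>(s, b) i. b ((i + int s) div int N) ! nat ((i + int s) mod int N))"

definition concat_measure :: "(int \<Rightarrow> nat) measure" where
  "concat_measure = distr (offsets \<Otimes>\<^sub>M blocks) (restrict_space borel (full_shift D)) concat_blocks"

lemma prob_space_W: "prob_space (uniform_count_measure W)"
  by (rule prob_space_uniform_count_measure[OF finite_W W_nonempty])

sublocale letters: product_prob_space "\<lambda>_::int. uniform_count_measure W" UNIV
proof -
  interpret prob_space "uniform_count_measure W" by (rule prob_space_W)
  show "product_prob_space (\<lambda>_::int. uniform_count_measure W)" by unfold_locales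
qed

lemma prob_space_blocks: "prob_space blocks"
  unfolding blocks_def by (rule prob_space_PiM[OF prob_space_W])

lemma prob_space_offsets: "prob_space offsets"
  unfolding offsets_def using N_pos by (intro prob_space_uniform_count_measure) auto

sublocale blocks: prob_space blocks by (rule prob_space_blocks)

sublocale offsets: prob_space offsets by (rule prob_space_offsets)

sublocale pair_prob_space offsets blocks ..

lemma space_blocks: "space blocks = {b. range b \<subseteq> W}"
  unfolding blocks_def space_PiM PiE_UNIV_domain by (auto simp: space_uniform_count_measure)

lemma space_offsets: "space offsets = {..<N}"
  by (simp add: offsets_def space_uniform_count_measure)

lemma sets_offsets: "sets offsets = sets (count_space {..<N})"
  by (simp add: offsets_def sets_uniform_count_measure)

lemma concat_blocks_full_shift:
  assumes "b \<in> space blocks"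
  shows "concat_blocks (s, b) \<in> full_shift D"
  unfolding full_shift_def
proof (rule CollectI, rule image_subsetI, simp only: atMost_iff)
  fix i
  let ?w = "b ((i + int s) div int N)" and ?r = "nat ((i + int s) mod int N)"
  have "range b \<subseteq> words D N" using assms W_words unfolding space_blocks by blast
  then have "?w \<in> words D N" by (rule range_subsetD)
  moreover have "?r < N" using N_pos by (simp add: nat_less_iff)
  ultimately have "?w ! ?r \<in> set ?w" "set ?w \<subseteq> {..D}" unfolding words_def by simp_all
  then show "concat_blocks (s, b) i \<le> D" by (auto simp: concat_blocks_def)
qed

lemma concat_blocks_measurable:
  "concat_blocks \<in> measurable (offsets \<Otimes>\<^sub>M blocks) (restrict_space borel (full_shift D))"
proof (rule measurable_restrict_space2)
  show "concat_blocks \<in> space (offsets \<Otimes>\<^sub>M blocks) \<rightarrow> full_shift D"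
    using concat_blocks_full_shift by (auto simp: space_pair_measure)
  have coord: "(\<lambda>\<omega>. concat_blocks \<omega> i) \<in> measurable (offsets \<Otimes>\<^sub>M blocks) (borel :: nat measure)" for i
  proof -
    have "(\<lambda>\<omega>. concat_blocks \<omega> i) \<in> measurable (count_space {..<N} \<Otimes>\<^sub>M blocks) (borel :: nat measure)"
    proof (rule measurable_pair_measure_countable1)
      fix s
      have "(\<lambda>b. b ((i + int s) div int N)) \<in> measurable blocks (uniform_count_measure W)"
        unfolding blocks_def by (rule measurable_component_singleton) simp
      moreover have "(\<lambda>w. w ! nat ((i + int s) mod int N)) \<in> measurable (uniform_count_measure W) (borel :: nat measure)"
        by (rule measurableI) (auto simp: sets_uniform_count_measure space_uniform_count_measure)
      ultimately show "(\<lambda>b. concat_blocks (s, b) i) \<in> measurable blocks (borel :: nat measure)"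
        unfolding concat_blocks_def prod.case by (rule measurable_compose)
    qed simp
    then show ?thesis
      using measurable_cong_sets[OF sets_pair_measure_cong[OF sets_offsets refl] refl] by blast
  qed
  have "concat_blocks \<in> measurable (offsets \<Otimes>\<^sub>M blocks) (Pi\<^sub>M UNIV (\<lambda>_. borel))"
    by (rule measurable_PiM_single') (use coord in auto)
  then show "concat_blocks \<in> measurable (offsets \<Otimes>\<^sub>M blocks) borel"
    using measurable_cong_sets[OF refl sets_PiM_equal_borel] by blast
qed

lemma sets_concat_measure: "sets concat_measure = sets (restrict_space borel (full_shift D))"
  by (simp add: concat_measure_def)

lemma space_concat_measure: "space concat_measure = full_shift D"
  by (simp add: concat_measure_def space_restrict_space)

lemma concat_blocks_section_sets:
  assumes "A \<in> sets concat_measure" "s < N"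
  shows "{b \<in> space blocks. concat_blocks (s, b) \<in> A} \<in> sets blocks"
proof -
  have "(\<lambda>b. concat_blocks (s, b)) \<in> measurable blocks (restrict_space borel (full_shift D))"
    using measurable_compose[OF measurable_Pair1' concat_blocks_measurable] assms(2)
    by (simp add: space_offsets)
  from measurable_sets[OF this] assms(1) show ?thesis
    by (simp add: sets_concat_measure vimage_def Int_def conj_commute)
qed

lemma measure_concat_measure:
  assumes A: "A \<in> sets concat_measure"
  shows "measure concat_measure A = (\<Sum>s<N. blocks.prob {b \<in> space blocks. concat_blocks (s, b) \<in> A}) / real N"
proof -
  let ?E = "concat_blocks -` A \<inter> space (offsets \<Otimes>\<^sub>M blocks)"
  have E: "?E \<in> sets (offsets \<Otimes>\<^sub>M blocks)"
    by (rule measurable_sets[OF concat_blocks_measurable]) (use A in \<open>simp add: sets_concat_measure\<close>)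
  have "emeasure concat_measure A = emeasure (offsets \<Otimes>\<^sub>M blocks) ?E"
    unfolding concat_measure_def
    by (rule emeasure_distr[OF concat_blocks_measurable]) (use A in \<open>simp add: sets_concat_measure\<close>)
  also have "\<dots> = (\<integral>\<^sup>+s. emeasure blocks (Pair s -` ?E) \<partial>offsets)"
    by (rule blocks.emeasure_pair_measure_alt[OF E])
  also have "\<dots> = (\<Sum>s<N. ennreal (1 / real N) * emeasure blocks (Pair s -` ?E))"
    unfolding offsets_def uniform_count_measure_def by (subst nn_integral_point_measure_finite) auto
  also have "\<dots> = (\<Sum>s<N. ennreal (blocks.prob {b \<in> space blocks. concat_blocks (s, b) \<in> A} / real N))"
  proof (rule sum.cong)
    fix s assume "s \<in> {..<N}"
    then have "Pair s -` ?E = {b \<in> space blocks. concat_blocks (s, b) \<in> A}"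
      by (auto simp: space_pair_measure space_offsets)
    then show "ennreal (1 / real N) * emeasure blocks (Pair s -` ?E)
        = ennreal (blocks.prob {b \<in> space blocks. concat_blocks (s, b) \<in> A} / real N)"
      by (simp add: blocks.emeasure_eq_measure ennreal_mult[symmetric])
  qed simp
  also have "\<dots> = ennreal ((\<Sum>s<N. blocks.prob {b \<in> space blocks. concat_blocks (s, b) \<in> A}) / real N)"
    by (simp add: sum_ennreal sum_divide_distrib)
  finally show ?thesis by (simp add: measure_def sum_nonneg)
qed

lemma prob_space_concat_measure: "prob_space concat_measure"
  unfolding concat_measure_def by (rule prob_space_distr[OF concat_blocks_measurable])

lemma shift_measurable: "shift_map \<in> measurable concat_measure concat_measure"
proof -
  have "shift_map \<in> measurable borel borel"
    unfolding shift_map_def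
    by (intro borel_measurable_continuous_onI continuous_on_coordinatewise_then_product continuous_on_product_coordinates)
  then have "shift_map \<in> measurable (restrict_space borel (full_shift D)) (restrict_space borel (full_shift D))"
    by (rule measurable_restrict_space3) (auto simp: full_shift_def shift_map_def image_subset_iff)
  then show ?thesis
    using measurable_cong_sets[OF sets_concat_measure sets_concat_measure] by blast
qed

text \<open>
  The shift increases the offset by one; at the end of a word it resets the offset and shifts the sequence
  of words instead. As words are independent and identically distributed, invariance follows.
\<close>

lemma shift_concat_blocks:
  assumes "s < N"
  shows "shift_map (concat_blocks (s, b)) =
    (if Suc s < N then concat_blocks (Suc s, b) else concat_blocks (0, \<lambda>j. b (j + 1)))"
proof (cases "Suc s < N")
  case True
  then show ?thesis by (simp add: concat_blocks_def shift_map_def algebra_simps)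
next
  case False
  then have "int s = int N - 1" using assms by simp
  then have eq: "i + 1 + int s = i + int N" for i by simp
  have "(i + 1 + int s) div int N = i div int N + 1" "(i + 1 + int s) mod int N = i mod int N" for i
    unfolding eq using N_pos by simp_all
  then show ?thesis using False by (simp add: concat_blocks_def shift_map_def)
qed

lemma distr_blocks_shift: "distr blocks blocks (\<lambda>b j. b (j + 1)) = blocks"
  using distr_PiM_reindex[of UNIV "\<lambda>_. uniform_count_measure W" "\<lambda>j::int. j + 1" UNIV, OF prob_space_W]
  by (simp add: blocks_def inj_def restrict_def)

lemma distr_concat_measure_shift: "distr concat_measure concat_measure shift_map = concat_measure"
proof (rule measure_eqI)
  interpret prob_space concat_measure by (rule prob_space_concat_measure)
  fix A assume "A \<in> sets (distr concat_measure concat_measure shift_map)"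
  then have A: "A \<in> sets concat_measure" by simp
  let ?A = "shift_map -` A \<inter> space concat_measure"
  have A': "?A \<in> sets concat_measure" by (rule measurable_sets[OF shift_measurable A])
  define h where "h s = blocks.prob {b \<in> space blocks. concat_blocks (s, b) \<in> A}" for s
  obtain m where m: "N = Suc m" using N_pos gr0_implies_Suc by blast
  have sec: "{b \<in> space blocks. concat_blocks (s, b) \<in> ?A} = {b \<in> space blocks. shift_map (concat_blocks (s, b)) \<in> A}" for s
    using concat_blocks_full_shift by (auto simp: space_concat_measure)
  have inner: "blocks.prob {b \<in> space blocks. concat_blocks (s, b) \<in> ?A} = h (Suc s)" if "s < m" for s
  proof -
    have "shift_map (concat_blocks (s, b)) = concat_blocks (Suc s, b)" for b
      using that m shift_concat_blocks[of s b] by simp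
    then show ?thesis by (simp only: sec h_def)
  qed
  have last: "blocks.prob {b \<in> space blocks. concat_blocks (m, b) \<in> ?A} = h 0"
  proof -
    have meas: "(\<lambda>b j. b (j + 1)) \<in> measurable blocks blocks"
      unfolding blocks_def by (rule measurable_PiM_single') (auto simp: space_PiM PiE_UNIV_domain)
    have set: "{b \<in> space blocks. concat_blocks (0, b) \<in> A} \<in> sets blocks"
      by (rule concat_blocks_section_sets[OF A N_pos])
    have "h 0 = measure (distr blocks blocks (\<lambda>b j. b (j + 1))) {b \<in> space blocks. concat_blocks (0, b) \<in> A}"
      by (simp add: h_def distr_blocks_shift)
    also have "\<dots> = blocks.prob ((\<lambda>b j. b (j + 1)) -` {b \<in> space blocks. concat_blocks (0, b) \<in> A} \<inter> space blocks)"
      by (rule measure_distr[OF meas set])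
    also have "(\<lambda>b j. b (j + 1)) -` {b \<in> space blocks. concat_blocks (0, b) \<in> A} \<inter> space blocks
        = {b \<in> space blocks. concat_blocks (m, b) \<in> ?A}"
    proof -
      have "shift_map (concat_blocks (m, b)) = concat_blocks (0, \<lambda>j. b (j + 1))" for b
        using m shift_concat_blocks[of m b] by simp
      then show ?thesis unfolding sec using measurable_space[OF meas] by auto
    qed
    finally show ?thesis by simp
  qed
  have "measure concat_measure ?A = ((\<Sum>s<m. h (Suc s)) + h 0) / real N"
  proof -
    have "{..<N} = insert m {..<m}" using m by auto
    then show ?thesis unfolding measure_concat_measure[OF A'] by (simp add: inner last del: Int_iff)
  qed
  also have "\<dots> = (\<Sum>s<N. h s) / real N"
    using m sum.lessThan_Suc_shift[of h m] by simp
  also have "\<dots> = measure concat_measure A"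
    unfolding measure_concat_measure[OF A] h_def ..
  finally have "measure concat_measure ?A = measure concat_measure A" .
  then show "emeasure (distr concat_measure concat_measure shift_map) A = emeasure concat_measure A"
    by (simp add: emeasure_distr[OF shift_measurable A] emeasure_eq_measure)
qed simp

lemma concat_measure_invariant: "concat_measure \<in> invariant_measures (full_shift D)"
  unfolding invariant_measures_def
  using prob_space_concat_measure sets_concat_measure shift_measurable distr_concat_measure_shift by simp

sublocale concat: invariant_full_shift_measure D concat_measure
  by unfold_locales (rule concat_measure_invariant)

lemma prob_blocks_values_le:
  assumes "finite J"
  shows "blocks.prob {b \<in> space blocks. \<forall>j\<in>J. b j = u j} \<le> (1 / real (card W)) ^ card J"
proof -
  have "{b \<in> space blocks. \<forall>j\<in>J. b j = u j} = {b \<in> space blocks. \<forall>j\<in>J. b j \<in> {u j} \<inter> W}"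
    by (auto simp: space_blocks)
  also have "emeasure blocks \<dots> = (\<Prod>j\<in>J. emeasure (uniform_count_measure W) ({u j} \<inter> W))"
    unfolding blocks_def using assms
    by (intro letters.emeasure_PiM_Collect) (auto simp: sets_uniform_count_measure)
  also have "\<dots> \<le> (\<Prod>j\<in>J. ennreal (1 / real (card W)))"
  proof (rule prod_mono_ennreal)
    fix j
    have "card ({u j} \<inter> W) \<le> 1" using card_mono[of "{u j}" "{u j} \<inter> W"] by simp
    then show "emeasure (uniform_count_measure W) ({u j} \<inter> W) \<le> ennreal (1 / real (card W))"
      by (subst emeasure_uniform_count_measure[OF finite_W]) (auto intro!: ennreal_leI divide_right_mono)
  qed
  also have "\<dots> = ennreal ((1 / real (card W)) ^ card J)"
    by (simp add: ennreal_power)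
  finally show ?thesis by (simp add: blocks.emeasure_eq_measure)
qed

text \<open>
  Whatever the offset, a block of length \<open>n\<close> contains the words with numbers \<open>1, \<dots>, n div N - 1\<close>
  completely, so it determines that many independent uniform choices.
\<close>

lemma prob_block_le:
  "measure concat_measure {x \<in> space concat_measure. block 0 n x = v} \<le> (1 / real (card W)) ^ (n div N - 1)"
proof -
  let ?c = "(1 / real (card W)) ^ (n div N - 1)"
  define J where "J = int ` {1..<n div N}"
  have J: "finite J" "card J = n div N - 1" by (auto simp: J_def card_image)
  have le: "blocks.prob {b \<in> space blocks. concat_blocks (s, b) \<in> {x \<in> space concat_measure. block 0 n x = v}} \<le> ?c"
    if s: "s < N" for s
  proof -
    define u where "u j = map (\<lambda>r. v ! nat (j * int N + int r - int s)) [0..<N]" for j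
    have "b j = u j" if b: "b \<in> space blocks" and v: "block 0 n (concat_blocks (s, b)) = v" and j: "j \<in> J" for b j
    proof (rule nth_equalityI)
      show len: "length (b j) = length (u j)"
        using b W_words by (auto simp: space_blocks u_def words_def)
      fix r assume "r < length (b j)"
      then have r: "r < N" using len by (simp add: u_def)
      obtain k where k: "j = int k" "1 \<le> k" "Suc k \<le> n div N" using j by (auto simp: J_def)
      have "Suc k * N \<le> n div N * N" using k(3) by (rule mult_le_mono1)
      also have "\<dots> \<le> n" by simp
      finally have kn: "k * N + N \<le> n" by simp
      have kN: "N \<le> k * N" using k(2) by simp
      define i where "i = k * N + r - s"
      have "s \<le> k * N + r" using kN s by linarith
      then have i: "i < n" "int i = j * int N + int r - int s"
        using kn r by (auto simp: i_def k(1) of_nat_diff)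
      have "v ! i = concat_blocks (s, b) (int i)"
        using i(1) by (simp add: v[symmetric] nth_block)
      also have "\<dots> = b j ! r"
        using r N_pos by (simp add: concat_blocks_def i(2))
      finally show "b j ! r = u j ! r" using r i by (simp add: u_def i(2)[symmetric])
    qed
    then have "{b \<in> space blocks. concat_blocks (s, b) \<in> {x \<in> space concat_measure. block 0 n x = v}}
        \<subseteq> {b \<in> space blocks. \<forall>j\<in>J. b j = u j}" by auto
    moreover have "{b \<in> space blocks. \<forall>j\<in>J. b j = u j} \<in> sets blocks"
    proof -
      have "{b \<in> space blocks. \<forall>j\<in>J. b j = u j} = space blocks \<inter> (\<Inter>j\<in>J. (\<lambda>b. b j) -` ({u j} \<inter> W) \<inter> space blocks)"
        by (auto simp: space_blocks)
      also have "\<dots> \<in> sets blocks"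
      proof (cases "J = {}")
        case False
        have "(\<lambda>b. b j) -` ({u j} \<inter> W) \<inter> space blocks \<in> sets blocks" for j
          unfolding blocks_def
          by (rule measurable_sets[OF measurable_component_singleton[of j UNIV "\<lambda>_. uniform_count_measure W"]])
            (auto simp: sets_uniform_count_measure)
        then have "(\<Inter>j\<in>J. (\<lambda>b. b j) -` ({u j} \<inter> W) \<inter> space blocks) \<in> sets blocks"
          using False J(1) by (intro sets.finite_INT) blast+
        then show ?thesis by (rule sets.Int[OF sets.top])
      qed simp
      finally show ?thesis .
    qed
    ultimately have "blocks.prob {b \<in> space blocks. concat_blocks (s, b) \<in> {x \<in> space concat_measure. block 0 n x = v}}
        \<le> blocks.prob {b \<in> space blocks. \<forall>j\<in>J. b j = u j}"
      by (rule blocks.finite_measure_mono)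
    also have "\<dots> \<le> ?c" using prob_blocks_values_le[OF J(1)] J(2) by simp
    finally show ?thesis .
  qed
  have "measure concat_measure {x \<in> space concat_measure. block 0 n x = v} \<le> (\<Sum>s<N. ?c) / real N"
    unfolding measure_concat_measure[OF concat.simple_function_event[OF concat.simple_function_block]]
    using le by (intro divide_right_mono sum_mono) auto
  also have "\<dots> = ?c" using N_pos by simp
  finally show ?thesis .
qed

text \<open>
  Take the partition by the letter at 0, whose itineraries are the blocks. All of them have probability at
  most \<open>(1 / card W) ^ (n div N - 1)\<close>, which bounds the entropy from below.
\<close>

lemma KS_entropy_concat_measure_ge:
  "ereal (ln (real (card W)) / real N) \<le> KS_entropy concat_measure shift_map"
proof -
  define Q where "Q a = {x \<in> full_shift D. x 0 = a}" for a
  define P where "P = Q ` {..D}"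
  have fin: "finite P" by (simp add: P_def)
  have sets: "P \<subseteq> sets concat_measure"
    using concat.simple_function_event[OF concat.simple_function_coordinate[of 0]]
    by (auto simp: P_def Q_def space_concat_measure)
  have part: "partition_on (space concat_measure) P"
  proof (rule partition_onI)
    show "\<Union>P = space concat_measure" by (auto simp: P_def Q_def space_concat_measure full_shift_def)
    have "(\<lambda>_. a) \<in> Q a" if "a \<le> D" for a
      using that by (auto simp: Q_def full_shift_def)
    then show "{} \<notin> P" unfolding P_def by blast
  next
    fix A B assume "A \<in> P" "B \<in> P" "A \<noteq> B"
    then show "disjnt A B" by (auto simp: P_def Q_def disjnt_def)
  qed
  have cell: "cell P x = Q (x 0)" if "x \<in> full_shift D" for x
    using that by (intro cell_eqI[OF part]) (auto simp: P_def Q_def full_shift_def)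
  have Q_inj: "Q a = Q c \<longleftrightarrow> a = c" if "a \<le> D" for a c
  proof
    have "(\<lambda>_. a) \<in> Q a" using that by (simp add: Q_def full_shift_def)
    then show "Q a = Q c \<Longrightarrow> a = c" by (auto simp: Q_def)
  qed simp
  have it_eq: "itinerary shift_map P n y = itinerary shift_map P n x \<longleftrightarrow> block 0 n y = block 0 n x"
    if "x \<in> full_shift D" "y \<in> full_shift D" for x y n
  proof -
    have "cell P ((shift_map ^^ i) z) = Q (z (int i))" if "z \<in> full_shift D" for z i
      using cell[of "(shift_map ^^ i) z"] that by (auto simp: shift_funpow full_shift_def)
    moreover have "y i \<le> D" for i using that(2) by (auto simp: full_shift_def)
    ultimately show ?thesis
      using that Q_inj by (simp add: itinerary_def block_def list_eq_iff_nth_eq)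
  qed
  have ent_ge: "(real n / real N - 2) * ln (real (card W)) \<le> ent concat_measure (itinerary shift_map P n)" for n
  proof -
    have card: "1 \<le> real (card W)" using W_nonempty finite_W by (simp add: Suc_le_eq card_gt_0_iff)
    have "n < (n div N + 1) * N"
      using dividend_less_div_times[OF N_pos, of n] by simp
    then have "real n < (real (n div N) + 1) * real N"
      by (metis of_nat_1 of_nat_add of_nat_less_iff of_nat_mult)
    then have "real n / real N < real (n div N) + 1"
      using N_pos by (simp add: pos_divide_less_eq)
    then have "real n / real N - 2 \<le> real (n div N - 1)" by linarith
    then have "(real n / real N - 2) * ln (real (card W)) \<le> real (n div N - 1) * ln (real (card W))"
      using card by (intro mult_right_mono) auto
    also have "\<dots> = - ln ((1 / real (card W)) ^ (n div N - 1))"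
      using card by (simp add: ln_realpow ln_div)
    also have "\<dots> \<le> ent concat_measure (itinerary shift_map P n)"
    proof (rule concat.ent_ge[OF concat.simple_function_itinerary[OF fin sets part]])
      fix x assume x: "x \<in> space concat_measure"
      have "{y \<in> space concat_measure. itinerary shift_map P n y = itinerary shift_map P n x}
          = {y \<in> space concat_measure. block 0 n y = block 0 n x}"
        using it_eq x by (auto simp: space_concat_measure)
      then show "concat.prob {y \<in> space concat_measure. itinerary shift_map P n y = itinerary shift_map P n x}
          \<le> (1 / real (card W)) ^ (n div N - 1)"
        using prob_block_le by simp
    qed
    finally show ?thesis .
  qed
  have "(\<lambda>n. ((real n / real N - 2) * ln (real (card W))) / real n) \<longlonglongrightarrow> inverse (real N) * ln (real (card W))"
    using N_pos by real_asymp
  moreover have "\<forall>n. ((real n / real N - 2) * ln (real (card W))) / real n \<le> ent concat_measure (itinerary shift_map P n) / real n"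
    using ent_ge by (auto intro!: divide_right_mono)
  ultimately have "inverse (real N) * ln (real (card W)) \<le> entropy_rate concat_measure shift_map P"
    by (intro LIMSEQ_le[OF _ concat.entropy_rate_tendsto[OF fin sets part]]) auto
  then have "ln (real (card W)) / real N \<le> entropy_rate concat_measure shift_map P"
    by (simp add: divide_inverse mult.commute)
  then show ?thesis
    unfolding KS_entropy_def by (intro SUP_upper2[of P]) (use fin sets part in auto)
qed

text \<open>
  The potential sees a word of \<open>W\<close> exactly if the offset is 0, which happens with probability \<open>1 / N\<close>. Its
  mean is therefore \<open>(N * \<mu> + (N - 1) * K) / N - K * (N - 1) / N = \<mu>\<close>.
\<close>

lemma pressure_word_potential_ge:
  assumes G: "G \<subseteq> marked_words D N" and W: "W \<subseteq> G" and m: "\<And>w. w \<in> W \<Longrightarrow> m w = \<mu>"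
  shows "ereal (t * \<mu> + ln (real (card W)) / real N)
    \<le> pressure (full_shift D) (\<lambda>x. t * word_potential N K G m (block 0 N x))"
proof -
  let ?f = "\<lambda>x. t * word_potential N K G m (block 0 N x)"
  define A where "A = {x \<in> space concat_measure. x 0 = 0}"
  define g where "g x = - t * K + t * real N * (\<mu> + K) * indicator A x" for x
  have A: "A \<in> sets concat_measure"
    unfolding A_def by (rule concat.simple_function_event[OF concat.simple_function_coordinate])
  have at_0: "concat_blocks (s, b) 0 = b 0 ! s" "concat_blocks (s, b) 0 = 0 \<longleftrightarrow> s = 0"
    if "s < N" "b \<in> space blocks" for s b
  proof -
    show 1: "concat_blocks (s, b) 0 = b 0 ! s" using that(1) by (simp add: concat_blocks_def)
    have "b 0 \<in> marked_words D N" using that(2) W G by (auto simp: space_blocks)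
    then show "concat_blocks (s, b) 0 = 0 \<longleftrightarrow> s = 0" unfolding 1 using that(1) by (simp add: marked_words_def)
  qed
  have in_A: "concat_blocks (s, b) \<in> A \<longleftrightarrow> s = 0" if "s < N" "b \<in> space blocks" for s b
    using at_0(2)[OF that] concat_blocks_full_shift[OF that(2), of s] by (simp add: A_def space_concat_measure)
  have "measure concat_measure A = (\<Sum>s<N. if s = 0 then 1 else 0) / real N"
    unfolding measure_concat_measure[OF A]
  proof (intro arg_cong2[where f = "(/)"] sum.cong refl)
    fix s assume s: "s \<in> {..<N}"
    have "{b \<in> space blocks. concat_blocks (s, b) \<in> A} = (if s = 0 then space blocks else {})"
      using in_A s by auto
    then show "blocks.prob {b \<in> space blocks. concat_blocks (s, b) \<in> A} = (if s = 0 then 1 else 0)"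
      by (simp add: blocks.prob_space)
  qed
  then have prob_A: "measure concat_measure A = 1 / real N" using N_pos by simp
  have eq: "?f (concat_blocks \<omega>) = g (concat_blocks \<omega>)" if \<omega>: "\<omega> \<in> space (offsets \<Otimes>\<^sub>M blocks)" for \<omega>
  proof -
    obtain s b where sb: "\<omega> = (s, b)" "s < N" "b \<in> space blocks"
      using \<omega> by (auto simp: space_pair_measure space_offsets)
    show ?thesis
    proof (cases "s = 0")
      case True
      have b0: "b 0 \<in> W" using sb(3) by (auto simp: space_blocks)
      then have "length (b 0) = N" using W_words by (auto simp: words_def)
      then have "block 0 N (concat_blocks (0, b)) = b 0"
        by (intro nth_equalityI) (simp_all add: nth_block concat_blocks_def)
      moreover have "b 0 \<in> G" "m (b 0) = \<mu>" using subsetD[OF W b0] m[OF b0] by this+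
      moreover have "concat_blocks (0, b) \<in> A" using in_A[of 0 b] N_pos sb(3) by simp
      ultimately show ?thesis
        by (simp add: sb(1) True word_potential_def g_def algebra_simps)
    next
      case False
      have "block 0 N (concat_blocks (s, b)) ! 0 \<noteq> 0"
        using at_0(2)[OF sb(2,3)] False N_pos by (simp add: nth_block)
      moreover have "w ! 0 = 0" if "w \<in> G" for w
        using subsetD[OF G that] N_pos by (simp add: marked_words_def)
      ultimately have "block 0 N (concat_blocks (s, b)) \<notin> G" by metis
      moreover have "concat_blocks (s, b) \<notin> A" using in_A[OF sb(2,3)] False by simp
      ultimately show ?thesis by (simp add: sb(1) word_potential_def g_def)
    qed
  qed
  have meas: "h \<in> borel_measurable (restrict_space borel (full_shift D))"
    if "h \<in> borel_measurable concat_measure" for h :: "_ \<Rightarrow> real"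
    using that measurable_cong_sets[OF sets_concat_measure refl] by blast
  have f_meas: "?f \<in> borel_measurable concat_measure"
    using concat.integrable_comp_simple_function[OF concat.simple_function_block[of 0 N],
        of "\<lambda>w. t * word_potential N K G m w"]
    by (rule borel_measurable_integrable)
  have g_meas: "g \<in> borel_measurable concat_measure" unfolding g_def using A by measurable
  have "integral\<^sup>L concat_measure ?f = (\<integral>\<omega>. ?f (concat_blocks \<omega>) \<partial>(offsets \<Otimes>\<^sub>M blocks))"
    unfolding concat_measure_def by (rule integral_distr[OF concat_blocks_measurable meas[OF f_meas]])
  also have "\<dots> = (\<integral>\<omega>. g (concat_blocks \<omega>) \<partial>(offsets \<Otimes>\<^sub>M blocks))"
    by (rule Bochner_Integration.integral_cong[OF refl eq])
  also have "\<dots> = integral\<^sup>L concat_measure g"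
    unfolding concat_measure_def by (rule integral_distr[OF concat_blocks_measurable meas[OF g_meas], symmetric])
  also have "\<dots> = - t * K + t * real N * (\<mu> + K) * (1 / real N)"
    unfolding g_def using A prob_A
    by (subst Bochner_Integration.integral_add) (auto simp: concat.emeasure_eq_measure concat.prob_space)
  also have "\<dots> = t * \<mu>" using N_pos by (simp add: field_simps)
  finally have int: "integral\<^sup>L concat_measure ?f = t * \<mu>" .
  have "ereal (t * \<mu> + ln (real (card W)) / real N) = ereal (ln (real (card W)) / real N) + ereal (t * \<mu>)"
    by simp
  also have "\<dots> \<le> KS_entropy concat_measure shift_map + ereal (integral\<^sup>L concat_measure ?f)"
    unfolding int by (rule add_right_mono[OF KS_entropy_concat_measure_ge])
  also have "\<dots> \<le> pressure (full_shift D) ?f"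
    unfolding pressure_def by (rule SUP_upper[OF concat_measure_invariant])
  finally show ?thesis .
qed

end

section \<open>Supporting lines and the choice of words\<close>

lemma ex_disjoint_subsets_card:
  assumes "finite I" "finite S" "sum k I \<le> card S"
  shows "\<exists>W. (\<forall>i\<in>I. W i \<subseteq> S \<and> card (W i) = k i) \<and> (\<forall>i\<in>I. \<forall>j\<in>I. i \<noteq> j \<longrightarrow> W i \<inter> W j = {})"
  using assms
proof (induction I arbitrary: S rule: finite_induct)
  case (insert a I)
  then have "k a \<le> card S" by simp
  then obtain V where V: "V \<subseteq> S" "card V = k a"
    using obtain_subset_with_card_n by metis
  then have "sum k I \<le> card (S - V)"
    using insert finite_subset[of V S] by (simp add: card_Diff_subset)
  then obtain W where W: "\<forall>i\<in>I. W i \<subseteq> S - V \<and> card (W i) = k i"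
    "\<forall>i\<in>I. \<forall>j\<in>I. i \<noteq> j \<longrightarrow> W i \<inter> W j = {}"
    using insert.IH[of "S - V"] insert.prems by auto
  let ?W = "W(a := V)"
  have "\<forall>i\<in>insert a I. ?W i \<subseteq> S \<and> card (?W i) = k i"
    using V W(1) insert.hyps by auto
  moreover have "\<forall>i\<in>insert a I. \<forall>j\<in>insert a I. i \<noteq> j \<longrightarrow> ?W i \<inter> ?W j = {}"
  proof (intro ballI impI)
    fix i j assume ij: "i \<in> insert a I" "j \<in> insert a I" "i \<noteq> j"
    have "W l \<inter> V = {}" if "l \<in> I" for l using W(1) that by blast
    then show "?W i \<inter> ?W j = {}" using ij W(2) by (simp add: fun_upd_def) blast
  qed
  ultimately show ?case by blast
qed simp

lemma card_marked_words_ge: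
  assumes "0 < N"
  shows "D ^ (N - 1) \<le> card (marked_words D N)"
proof -
  let ?L = "{u. set u \<subseteq> {1..D} \<and> length u = N - 1}"
  have "card ((#) 0 ` ?L) = D ^ (N - 1)"
    by (subst card_image) (auto simp: card_lists_length_eq)
  moreover have "(#) 0 ` ?L \<subseteq> marked_words D N"
  proof
    fix w assume "w \<in> (#) 0 ` ?L"
    then obtain u where u: "w = 0 # u" "set u \<subseteq> {1..D}" "length u = N - 1" by auto
    have "u ! i \<noteq> 0" if "i < N - 1" for i
    proof -
      have "u ! i \<in> {1..D}" using that u(3) by (intro subsetD[OF u(2)] nth_mem) simp
      then show ?thesis by simp
    qed
    then show "w \<in> marked_words D N"
      using u assms by (auto simp: marked_words_def words_def nth_Cons')
  qed
  moreover have "finite (marked_words D N)"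
    using finite_words[of D N] unfolding marked_words_def by (auto intro: finite_subset)
  ultimately show ?thesis using card_mono[of "marked_words D N" "(#) 0 ` ?L"] by simp
qed

lemma locally_constant_on_block:
  "locally_constant_on X (\<lambda>x. f (block 0 N x))"
  unfolding locally_constant_on_def
proof (intro exI[of _ N] ballI impI)
  fix x y :: "int \<Rightarrow> nat" assume "\<forall>i\<in>{- int N..int N}. x i = y i"
  then have "block 0 N x = block 0 N y" by (intro nth_equalityI) (auto simp: nth_block)
  then show "f (block 0 N x) = f (block 0 N y)" by simp
qed

text \<open>
  Potentials whose pressure is, up to \<open>e\<close>, the maximum of finitely many lines with intercepts in
  \<open>[0, \<gamma>]\<close>, as long as the letters outside marked words have total weight at most \<open>1 / 2\<close>. Neither the alphabet nor \<open>K\<close> depends on the number of lines; only the word length does.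
\<close>

lemma ex_word_potential:
  fixes c m :: "nat \<Rightarrow> real"
  assumes c: "\<And>j. j \<le> n \<Longrightarrow> 0 \<le> c j" "\<And>j. j \<le> n \<Longrightarrow> c j \<le> \<gamma>"
    and D: "exp (\<gamma> + 1) \<le> real D" and e: "0 < e"
  shows "\<exists>\<phi>. (\<forall>X. locally_constant_on X \<phi>) \<and>
    (\<forall>t p. (\<forall>j\<le>n. t * m j + c j + e \<le> p) \<and> (real D + 1) * exp (- t * K - p) \<le> 1 / 2 \<longrightarrow>
      pressure (full_shift D) (\<lambda>x. t * \<phi> x) \<le> ereal p) \<and>
    (\<forall>t. \<forall>j\<le>n. ereal (t * m j + c j - e) \<le> pressure (full_shift D) (\<lambda>x. t * \<phi> x))"
proof -
  have "eventually (\<lambda>N. 1 \<le> N) sequentially" by (rule eventually_ge_at_top)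
  moreover have "eventually (\<lambda>N. (real n + 1) * exp (- real N * e) \<le> 1 / 2) sequentially"
    using e by real_asymp
  \<comment> \<open>With \<open>D \<ge> exp (\<gamma> + 1)\<close> this makes room for \<open>n + 1\<close> disjoint sets of \<open>exp (N * \<gamma>)\<close> among the
     \<open>D ^ (N - 1)\<close> marked words.\<close>
  moreover have "eventually (\<lambda>N. real n + 1 \<le> exp (real N - \<gamma> - 1)) sequentially"
    by real_asymp
  moreover have "eventually (\<lambda>N. ln 2 \<le> e * real N) sequentially"
    using e by real_asymp
  ultimately have "eventually (\<lambda>N. 1 \<le> N \<and> (real n + 1) * exp (- real N * e) \<le> 1 / 2 \<and>
      real n + 1 \<le> exp (real N - \<gamma> - 1) \<and> ln 2 \<le> e * real N) sequentially"
    by eventually_elim simp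
  then obtain N :: nat where N: "1 \<le> N" "(real n + 1) * exp (- real N * e) \<le> 1 / 2"
      "real n + 1 \<le> exp (real N - \<gamma> - 1)" "ln 2 \<le> e * real N"
    unfolding eventually_sequentially by blast
  define k where "k j = nat \<lfloor>exp (real N * c j)\<rfloor>" for j
  have k_le: "real (k j) \<le> exp (real N * c j)" for j
    by (simp add: k_def of_nat_floor)
  \<comment> \<open>Rounding down at most halves a number that is at least 1; this is where \<open>c j \<ge> 0\<close> enters.\<close>
  have k_ge: "exp (real N * c j) / 2 \<le> real (k j)" "1 \<le> k j" if "j \<le> n" for j
  proof -
    have 1: "1 \<le> exp (real N * c j)" using c(1)[OF that] by simp
    then show "1 \<le> k j" by (simp add: k_def le_nat_floor)
    moreover have "exp (real N * c j) < real (k j) + 1" unfolding k_def by linarith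
    ultimately show "exp (real N * c j) / 2 \<le> real (k j)" by linarith
  qed
  have "real (k j) \<le> exp (real N * \<gamma>)" if "j \<le> n" for j
    by (rule order_trans[OF k_le]) (use c(2)[OF that] in \<open>simp add: mult_left_mono\<close>)
  then have "real (\<Sum>j\<le>n. k j) \<le> (\<Sum>j\<le>n. exp (real N * \<gamma>))"
    unfolding of_nat_sum by (intro sum_mono) simp
  also have "\<dots> = (real n + 1) * exp (real N * \<gamma>)" by simp
  also have "\<dots> \<le> exp (real N - \<gamma> - 1) * exp (real N * \<gamma>)"
    using N(3) by (intro mult_right_mono) auto
  also have "\<dots> = exp (\<gamma> + 1) ^ (N - 1)"
    using N(1) by (simp add: exp_add[symmetric] exp_of_nat_mult[symmetric] of_nat_diff algebra_simps)
  also have "\<dots> \<le> real D ^ (N - 1)" using D by (intro power_mono) auto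
  also have "\<dots> = real (D ^ (N - 1))" by simp
  also have "\<dots> \<le> real (card (marked_words D N))"
    using card_marked_words_ge[of N D] N(1) by (simp only: of_nat_le_iff)
  finally have "(\<Sum>j\<le>n. k j) \<le> card (marked_words D N)" by (simp only: of_nat_le_iff)
  moreover have fin: "finite (marked_words D N)"
    using finite_words[of D N] unfolding marked_words_def by (auto intro: finite_subset)
  ultimately have "\<exists>W. (\<forall>i\<in>{..n}. W i \<subseteq> marked_words D N \<and> card (W i) = k i) \<and>
      (\<forall>i\<in>{..n}. \<forall>j\<in>{..n}. i \<noteq> j \<longrightarrow> W i \<inter> W j = {})"
    by (intro ex_disjoint_subsets_card) simp_all
  then obtain W where W_all: "\<forall>i\<in>{..n}. W i \<subseteq> marked_words D N \<and> card (W i) = k i"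
      "\<forall>i\<in>{..n}. \<forall>j\<in>{..n}. i \<noteq> j \<longrightarrow> W i \<inter> W j = {}" by (elim exE conjE)
  have W: "\<And>j. j \<le> n \<Longrightarrow> W j \<subseteq> marked_words D N" "\<And>j. j \<le> n \<Longrightarrow> card (W j) = k j"
      "\<And>i j. i \<le> n \<Longrightarrow> j \<le> n \<Longrightarrow> i \<noteq> j \<Longrightarrow> W i \<inter> W j = {}"
    using W_all by simp_all
  define G where "G = (\<Union>j\<le>n. W j)"
  define s where "s w = m (THE j. j \<le> n \<and> w \<in> W j)" for w
  have G: "G \<subseteq> marked_words D N" using W(1) by (auto simp: G_def)
  have s: "s w = m j" if "j \<le> n" "w \<in> W j" for w j
  proof -
    have "(THE j. j \<le> n \<and> w \<in> W j) = j" using that W(3) by (intro the_equality) auto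
    then show ?thesis by (simp add: s_def)
  qed
  define \<phi> where "\<phi> x = word_potential N K G s (block 0 N x)" for x
  show ?thesis
  proof (intro exI[of _ \<phi>] conjI allI impI)
    show "locally_constant_on X \<phi>" for X
      unfolding \<phi>_def[abs_def] by (rule locally_constant_on_block)
  next
    fix t p assume *: "(\<forall>j\<le>n. t * m j + c j + e \<le> p) \<and> (real D + 1) * exp (- t * K - p) \<le> 1 / 2"
    have "(\<Sum>w\<in>G. exp (real N * (t * s w - p))) = (\<Sum>j\<le>n. \<Sum>w\<in>W j. exp (real N * (t * s w - p)))"
      unfolding G_def using W(1,3) fin by (intro sum.UNION_disjoint) (auto intro: finite_subset)
    also have "\<dots> = (\<Sum>j\<le>n. real (k j) * exp (real N * (t * m j - p)))"
      by (intro sum.cong) (auto simp: s W(2))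
    also have "\<dots> \<le> (\<Sum>j\<le>n. exp (- real N * e))"
    proof (rule sum_mono)
      fix j assume j: "j \<in> {..n}"
      have "real (k j) * exp (real N * (t * m j - p)) \<le> exp (real N * c j) * exp (real N * (t * m j - p))"
        by (intro mult_right_mono k_le) simp
      also have "\<dots> = exp (real N * (t * m j + c j - p))" by (simp add: exp_add[symmetric] algebra_simps)
      also have "\<dots> \<le> exp (real N * - e)"
      proof -
        have "t * m j + c j - p \<le> - e" using * j by auto
        then show ?thesis by (simp only: exp_le_cancel_iff) (intro mult_left_mono, auto)
      qed
      finally show "real (k j) * exp (real N * (t * m j - p)) \<le> exp (- real N * e)" by simp
    qed
    also have "\<dots> \<le> 1 / 2" using N(2) by (simp add: add.commute)
    finally have "(real D + 1) * exp (- t * K - p) + (\<Sum>w\<in>G. exp (real N * (t * s w - p))) \<le> 1"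
      using * by simp
    then show "pressure (full_shift D) (\<lambda>x. t * \<phi> x) \<le> ereal p"
      unfolding \<phi>_def using N(1) G by (intro pressure_word_potential_le) auto
  next
    fix t j assume j: "j \<le> n"
    have "W j \<subseteq> words D N" "W j \<noteq> {}"
      using W(1)[OF j] W(2)[OF j] k_ge(2)[OF j] by (auto simp: marked_words_def)
    then interpret block_code D N "W j" using N(1) by unfold_locales auto
    have "ln (exp (real N * c j) / 2) \<le> ln (real (card (W j)))"
      using k_ge[OF j] W(2)[OF j] by (subst ln_le_cancel_iff) auto
    then have "real N * c j - ln 2 \<le> ln (real (card (W j)))" by (simp add: ln_div)
    then have "real N * (c j - e) \<le> ln (real (card (W j)))" using N(4) by (simp add: algebra_simps)
    then have "c j - e \<le> ln (real (card (W j))) / real N"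
      using N(1) by (simp add: pos_le_divide_eq mult.commute)
    then have "ereal (t * m j + c j - e) \<le> ereal (t * m j + ln (real (card (W j))) / real N)" by simp
    also have "\<dots> \<le> pressure (full_shift D) (\<lambda>x. t * \<phi> x)"
      unfolding \<phi>_def using G s j by (intro pressure_word_potential_ge) (auto simp: G_def)
    finally show "ereal (t * m j + c j - e) \<le> pressure (full_shift D) (\<lambda>x. t * \<phi> x)" .
  qed
qed

lemma ex_supporting_line:
  fixes F :: "real \<Rightarrow> real"
  assumes "convex_on I F" "open I" "x \<in> I"
  shows "\<exists>m c. supporting_line_at I F x m c"
proof -
  define m where "m = Inf ((\<lambda>t. (F x - F t) / (x - t)) ` ({x<..} \<inter> I))"
  have "F x + m * (y - x) \<le> F y" if "y \<in> I" for y
    unfolding m_def using convex_le_Inf_differential[OF assms(1) _ that, of x] assms(2,3)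
    by (simp add: interior_open)
  then have "supporting_line_at I F x m (F x - m * x)"
    unfolding supporting_line_at_def by (auto simp: algebra_simps)
  then show ?thesis by blast
qed

lemma supporting_line_slope_le:
  fixes F :: "real \<Rightarrow> real"
  assumes line: "supporting_line_at I F x m c" and "L-lipschitz_on I F" "open I" "x \<in> I"
  shows "\<bar>m\<bar> \<le> L"
proof -
  obtain d where d: "0 < d" "cball x d \<subseteq> I" using assms open_contains_cball by blast
  have I: "x + d \<in> I" "x - d \<in> I" using d by (auto simp: dist_real_def subset_iff)
  have "\<bar>F (x + d) - F x\<bar> \<le> L * d" "\<bar>F (x - d) - F x\<bar> \<le> L * d"
    using lipschitz_onD[OF assms(2) I(1) assms(4)] lipschitz_onD[OF assms(2) I(2) assms(4)] d(1)
    by (simp_all add: dist_real_def)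
  moreover have "F x + m * d \<le> F (x + d)" "F x - m * d \<le> F (x - d)"
    using line I unfolding supporting_line_at_def by (force simp: algebra_simps)+
  ultimately have "m * d \<le> L * d" "- m * d \<le> L * d" by (simp_all add: abs_le_iff)
  then have "m \<le> L" "- m \<le> L" using d(1) mult_right_le_imp_le by blast+
  then show ?thesis by (simp add: abs_le_iff)
qed

theorem corollary1p4:
  fixes \<alpha> L \<gamma>\<^sub>l \<gamma>\<^sub>u :: real and F :: "real \<Rightarrow> real"
  assumes "\<alpha> > 0" and "L > 0"
    and "convex_on {\<alpha><..} F"
    and "L-lipschitz_on {\<alpha><..} F"
    and "0 \<le> \<gamma>\<^sub>l" and "\<gamma>\<^sub>l \<le> \<gamma>\<^sub>u"
    and "\<And>t\<^sub>0 m c. t\<^sub>0 \<in> {\<alpha><..} \<Longrightarrow> supporting_line_at {\<alpha><..} F t\<^sub>0 m c \<Longrightarrow> c \<in> {\<gamma>\<^sub>l..\<gamma>\<^sub>u}"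
  shows "\<exists>(X :: (int \<Rightarrow> nat) set) (\<phi> :: nat \<Rightarrow> (int \<Rightarrow> nat) \<Rightarrow> real).
           shift_of_finite_type X \<and>
           (\<forall>n. locally_constant_on X (\<phi> n)) \<and>
           (\<forall>t\<in>{\<alpha><..}. (\<lambda>n. pressure X (\<lambda>x. t * \<phi> n x)) \<longlonglongrightarrow> ereal (F t))"
proof -
  \<comment> \<open>A sequence that runs through all rationals above \<open>\<alpha>\<close>; the value \<open>\<alpha> + 1\<close> is a dummy.\<close>
  define \<tau> where "\<tau> i = (let r = real_of_rat (nat_to_rat_surj i) in if \<alpha> < r then r else \<alpha> + 1)" for i
  have \<tau>: "\<tau> i \<in> {\<alpha><..}" for i by (simp add: \<tau>_def Let_def)
  have "\<forall>i. \<exists>m c. supporting_line_at {\<alpha><..} F (\<tau> i) m c"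
    using ex_supporting_line[OF assms(3) _ \<tau>] by simp
  then obtain m c where line: "\<And>i. supporting_line_at {\<alpha><..} F (\<tau> i) (m i) (c i)" by metis
  have c: "0 \<le> c i" "c i \<le> \<gamma>\<^sub>u" for i using assms(5) assms(7)[OF \<tau> line, of i] by auto
  have m: "\<bar>m i\<bar> \<le> L" for i
    by (rule supporting_line_slope_le[OF line assms(4) _ \<tau>]) simp
  have below: "m i * t + c i \<le> F t" if "t \<in> {\<alpha><..}" for i t
    using line[of i] that unfolding supporting_line_at_def by blast
  have dense: "\<exists>i. F t - e < m i * t + c i" if t: "t \<in> {\<alpha><..}" and e: "0 < e" for t e
  proof -
    define d where "d = e / (2 * L)"
    have "0 < d" using e assms(2) by (simp add: d_def)
    then obtain r where r: "t < real_of_rat r" "real_of_rat r < t + d"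
      using of_rat_dense[of t "t + d"] by auto
    obtain i where "nat_to_rat_surj i = r" using surj_nat_to_rat_surj by (metis surjD)
    then have i: "\<tau> i = real_of_rat r" using r(1) t by (simp add: \<tau>_def)
    have "F t - F (\<tau> i) \<le> L * \<bar>t - \<tau> i\<bar>"
      using lipschitz_onD[OF assms(4) t \<tau>[of i]] by (simp add: dist_real_def)
    moreover have "m i * (\<tau> i - t) \<le> L * \<bar>t - \<tau> i\<bar>"
      using m[of i] r(1) i by (intro mult_mono) (auto simp: abs_le_iff)
    moreover have "m i * \<tau> i + c i = F (\<tau> i)" using line[of i] by (simp add: supporting_line_at_def)
    ultimately have "F t - 2 * (L * \<bar>t - \<tau> i\<bar>) \<le> m i * t + c i" by (simp add: algebra_simps)
    moreover have "L * \<bar>t - \<tau> i\<bar> < L * d"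
      using r i assms(2) by (intro mult_strict_left_mono) auto
    moreover have "2 * (L * d) = e" using assms(2) by (simp add: d_def)
    ultimately show ?thesis by (intro exI[of _ i]) linarith
  qed
  define D where "D = nat \<lceil>exp (\<gamma>\<^sub>u + 1)\<rceil>"
  have D: "exp (\<gamma>\<^sub>u + 1) \<le> real D" unfolding D_def by linarith
  \<comment> \<open>The bound \<open>F t \<ge> - L * t\<close> holds since slopes are at least \<open>- L\<close> and intercepts are nonnegative.
     With this \<open>K\<close>, as \<open>t / \<alpha> > 1\<close>, junk letters get total weight
     \<open>(D + 1) * exp (- t * K - F t) \<le> 1 / 2\<close>.\<close>
  define K where "K = L + ln (2 * (real D + 1)) / \<alpha>"
  define approximant where "approximant n \<phi> \<longleftrightarrow> (\<forall>X. locally_constant_on X \<phi>) \<and>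
    (\<forall>t p. (\<forall>j\<le>n. t * m j + c j + 1 / (real n + 1) \<le> p) \<and> (real D + 1) * exp (- t * K - p) \<le> 1 / 2 \<longrightarrow>
      pressure (full_shift D) (\<lambda>x. t * \<phi> x) \<le> ereal p) \<and>
    (\<forall>t. \<forall>j\<le>n. ereal (t * m j + c j - 1 / (real n + 1)) \<le> pressure (full_shift D) (\<lambda>x. t * \<phi> x))"
    for n and \<phi> :: "(int \<Rightarrow> nat) \<Rightarrow> real"
  have "\<exists>\<phi>. approximant n \<phi>" for n
    unfolding approximant_def by (rule ex_word_potential) (use c D in auto)
  then obtain \<phi> where "\<And>n. approximant n (\<phi> n)" by metis
  then have \<phi>: "\<And>n X. locally_constant_on X (\<phi> n)"
    "\<And>n t p. (\<forall>j\<le>n. t * m j + c j + 1 / (real n + 1) \<le> p) \<Longrightarrow> (real D + 1) * exp (- t * K - p) \<le> 1 / 2 \<Longrightarrow>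
      pressure (full_shift D) (\<lambda>x. t * \<phi> n x) \<le> ereal p"
    "\<And>n t j. j \<le> n \<Longrightarrow> ereal (t * m j + c j - 1 / (real n + 1)) \<le> pressure (full_shift D) (\<lambda>x. t * \<phi> n x)"
    unfolding approximant_def by simp_all
  have upper: "pressure (full_shift D) (\<lambda>x. t * \<phi> n x) \<le> ereal (F t + 1 / (real n + 1))" if t: "t \<in> {\<alpha><..}" for t n
  proof (rule \<phi>(2))
    show "\<forall>j\<le>n. t * m j + c j + 1 / (real n + 1) \<le> F t + 1 / (real n + 1)"
      using below[OF t] by (simp add: mult.commute)
    have "- (t * L) \<le> t * m 0" using t assms(1) m[of 0] mult_left_mono[of "- L" "m 0" t] by (auto simp: abs_le_iff)
    then have F_ge: "- (t * L) \<le> F t" using below[OF t, of 0] c(1)[of 0] by (simp add: mult.commute)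
    have "ln (2 * (real D + 1)) * 1 \<le> ln (2 * (real D + 1)) * (t / \<alpha>)"
      using t assms(1) by (intro mult_left_mono) auto
    then have "ln (2 * (real D + 1)) \<le> t * K - t * L"
      by (simp add: K_def algebra_simps)
    then have "- t * K - (F t + 1 / (real n + 1)) \<le> - ln (2 * (real D + 1))"
      using F_ge by (smt (verit) divide_nonneg_nonneg mult_minus_left of_nat_0_le_iff)
    then have "exp (- t * K - (F t + 1 / (real n + 1))) \<le> exp (- ln (2 * (real D + 1)))" by simp
    also have "\<dots> = 1 / (2 * (real D + 1))" by (subst exp_minus, subst exp_ln) (auto simp: inverse_eq_divide)
    finally show "(real D + 1) * exp (- t * K - (F t + 1 / (real n + 1))) \<le> 1 / 2"
      by (simp add: field_simps)
  qed
  have "(\<lambda>n. pressure (full_shift D) (\<lambda>x. t * \<phi> n x)) \<longlonglongrightarrow> ereal (F t)" if t: "t \<in> {\<alpha><..}" for t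
  proof (rule order_tendstoI)
    fix a assume "a < ereal (F t)"
    then obtain b where b: "a < ereal b" "b < F t" using ereal_dense2[of a "ereal (F t)"] by auto
    define e where "e = (F t - b) / 2"
    have e: "0 < e" and F_t: "F t = b + 2 * e" using b(2) by (simp_all add: e_def field_simps)
    obtain i where i: "F t - e < m i * t + c i" using dense[OF t e] by blast
    have "eventually (\<lambda>n. 1 / (real n + 1) < e) sequentially" using e by real_asymp
    with eventually_ge_at_top[of i]
    show "eventually (\<lambda>n. a < pressure (full_shift D) (\<lambda>x. t * \<phi> n x)) sequentially"
    proof eventually_elim
      case (elim n)
      have "b < t * m i + c i - 1 / (real n + 1)" using elim(2) i F_t by (simp add: mult.commute)
      then have "ereal b < ereal (t * m i + c i - 1 / (real n + 1))" by simp
      also have "\<dots> \<le> pressure (full_shift D) (\<lambda>x. t * \<phi> n x)" by (rule \<phi>(3)[OF elim(1)])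
      finally show ?case using b(1) by (rule less_trans[rotated])
    qed
  next
    fix a assume a: "ereal (F t) < a"
    have "(\<lambda>n. F t + 1 / (real n + 1)) \<longlonglongrightarrow> F t" by real_asymp
    then have "(\<lambda>n. ereal (F t + 1 / (real n + 1))) \<longlonglongrightarrow> ereal (F t)" by simp
    then have "eventually (\<lambda>n. ereal (F t + 1 / (real n + 1)) < a) sequentially"
      using a by (rule order_tendstoD(2))
    then show "eventually (\<lambda>n. pressure (full_shift D) (\<lambda>x. t * \<phi> n x) < a) sequentially"
      by eventually_elim (use upper[OF t] in \<open>auto intro: le_less_trans\<close>)
  qed
  then show ?thesis
    using shift_of_finite_type_full_shift[of D] \<phi>(1)
    by (intro exI[of _ "full_shift D"] exI[of _ \<phi>]) auto
qed

end
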